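(* Let $M$ be an oriented Riemannian 3-manifold with boundary and $(B,p)$ be an MHD equilibrium on $M$. Let $\gamma \subset \mathrm{int}\, M$ be an embedded circle which is also a Morse-Bott critical submanifold for $p$. Then, setting $J = \operatorname{curl} B$, the following holds. 1. If $p$ is locally maximised on $\gamma$, then either (a) $B|_\gamma = 0$ and $J|_\gamma$ has no zeros, or (b) $B|_\gamma$ has no zeros and $J|_\gamma = k B|_\gamma$ for some $k \in \mathbb{R}$. 2. If $p$ is locally minimised on $\gamma$, then $B|_\gamma$ has no zeros and $J|_\gamma = k B|_\gamma$ for some $k \in \mathbb{R}$.
   Context: Everything is smooth. An MHD equilibrium on an oriented Riemannian 3-manifold $M$ with boundary is a pair $(B,p)$ of a smooth vector field $B$ and a smooth function $p$ on $M$ with $\operatorname{curl} B \times B = \nabla p$, $\operatorname{div} B = 0$, and $B \cdot n = 0$ on $\partial M$, where $n$ is the outward unit normal; curl, cross product, divergence and gradient are those of the Riemannian metric and orientation. An embedded circle $\gamma\subset \mathrm{int}\, M$ is a Morse-Bott critical submanifold for $p$ if $dp|_\gamma=0$ and, for all $x\in\gamma$, the Hessian $\operatorname{Hess}(p)|_x:T_xM\times T_xM\to\mathbb{R}$ is non-degenerate once restricted to one (and hence any) plane $\pi\subset T_xM$ transverse to $\gamma$ at $x$. That $p$ is locally maximised (minimised) on $\gamma$ means that the points of $\gamma$ are local maxima (minima) of $p$. *)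

theory Defs
  imports "HOL-Analysis.Analysis"
begin

section \<open>Smooth maps\<close>

text \<open>Continuity of all iterated directional derivatives up to order \<open>n\<close>; meant for open \<open>S\<close>.\<close>

primrec C_k_on :: "nat \<Rightarrow> 'a::real_normed_vector set \<Rightarrow> ('a \<Rightarrow> 'b::real_normed_vector) \<Rightarrow> bool" where
  "C_k_on 0 S f \<longleftrightarrow> continuous_on S f"
| "C_k_on (Suc n) S f \<longleftrightarrow>
     (\<forall>x\<in>S. f differentiable (at x)) \<and>
     (\<forall>v. C_k_on n S (\<lambda>x. frechet_derivative f (at x) v))"

text \<open>On a set that is not open, smooth means: locally the restriction of a smooth map
  defined on an open set.\<close>

definition smooth_on :: "'a::real_normed_vector set \<Rightarrow> ('a \<Rightarrow> 'b::real_normed_vector) \<Rightarrow> bool" where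
  "smooth_on S f \<longleftrightarrow>
     (\<forall>x\<in>S. \<exists>W F. open W \<and> x \<in> W \<and> (\<forall>n. C_k_on n W F) \<and> (\<forall>y\<in>S \<inter> W. F y = f y))"

section \<open>Oriented 3-manifolds with boundary\<close>

definition half_space :: "(real^3) set" where
  "half_space = {y. y $ 3 \<ge> 0}"

text \<open>A chart is a pair of its domain and its coordinate map; the values of the map outside
  the domain are irrelevant.\<close>

type_synonym 'm chart = "'m set \<times> ('m \<Rightarrow> real^3)"

abbreviation cdom :: "'m chart \<Rightarrow> 'm set" where "cdom \<equiv> fst"
abbreviation cmap :: "'m chart \<Rightarrow> 'm \<Rightarrow> real^3" where "cmap \<equiv> snd"

definition cinv :: "'m chart \<Rightarrow> real^3 \<Rightarrow> 'm" where
  "cinv c = inv_into (cdom c) (cmap c)"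

definition is_chart :: "'m::topological_space chart \<Rightarrow> bool" where
  "is_chart c \<longleftrightarrow>
     open (cdom c) \<and>
     openin (top_of_set half_space) (cmap c ` cdom c) \<and>
     homeomorphism (cdom c) (cmap c ` cdom c) (cmap c) (cinv c)"

text \<open>Derivative, in the coordinates of \<open>c\<close> and at the point \<open>x\<close>, of a map on the manifold.
  It is taken within the half-space, where derivatives are still unique, so that the
  definition also makes sense at boundary points.\<close>

definition chart_deriv ::
    "'m chart \<Rightarrow> ('m \<Rightarrow> 'b::real_normed_vector) \<Rightarrow> 'm \<Rightarrow> real^3 \<Rightarrow> 'b" where
  "chart_deriv c f x = frechet_derivative (f \<circ> cinv c) (at (cmap c x) within half_space)"

definition partial :: "'m chart \<Rightarrow> 3 \<Rightarrow> ('m \<Rightarrow> 'b::real_normed_vector) \<Rightarrow> 'm \<Rightarrow> 'b" where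
  "partial c i f x = chart_deriv c f x (axis i 1)"

definition jacobian :: "'m chart \<Rightarrow> 'm chart \<Rightarrow> 'm \<Rightarrow> real^3^3" where
  "jacobian c d x = matrix (chart_deriv c (cmap d) x)"

text \<open>The orientation is the one for which all charts of the atlas are positive.\<close>

definition oriented_3_manifold ::
    "'m::{t2_space,second_countable_topology} chart set \<Rightarrow> bool" where
  "oriented_3_manifold A \<longleftrightarrow>
     (\<forall>c\<in>A. is_chart c) \<and>
     (\<Union>c\<in>A. cdom c) = UNIV \<and>
     (\<forall>c\<in>A. \<forall>d\<in>A. smooth_on (cmap c ` (cdom c \<inter> cdom d)) (cmap d \<circ> cinv c) \<and>
        (\<forall>x\<in>cdom c \<inter> cdom d. det (jacobian c d x) > 0))"

definition boundary_points :: "'m chart set \<Rightarrow> 'm set" where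
  "boundary_points A = {x. \<exists>c\<in>A. x \<in> cdom c \<and> cmap c x $ 3 = 0}"

definition interior_points :: "'m chart set \<Rightarrow> 'm set" where
  "interior_points A = - boundary_points A"

section \<open>Functions, vector fields and metrics\<close>

definition smooth_function :: "'m chart set \<Rightarrow> ('m \<Rightarrow> real) \<Rightarrow> bool" where
  "smooth_function A f \<longleftrightarrow> (\<forall>c\<in>A. smooth_on (cmap c ` cdom c) (f \<circ> cinv c))"

text \<open>A vector field is given by its components: \<open>X c x\<close> is the component vector, in the
  chart \<open>c\<close>, of the tangent vector at \<open>x\<close>. Only charts of the atlas whose domain contains
  \<open>x\<close> matter. Likewise \<open>g c x\<close> is the Gram matrix of a metric at \<open>x\<close>.\<close>

type_synonym 'm vfield = "'m chart \<Rightarrow> 'm \<Rightarrow> real^3"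
type_synonym 'm metric_tensor = "'m chart \<Rightarrow> 'm \<Rightarrow> real^3^3"

definition smooth_vector_field :: "'m chart set \<Rightarrow> 'm vfield \<Rightarrow> bool" where
  "smooth_vector_field A X \<longleftrightarrow>
     (\<forall>c\<in>A. smooth_on (cmap c ` cdom c) (X c \<circ> cinv c)) \<and>
     (\<forall>c\<in>A. \<forall>d\<in>A. \<forall>x\<in>cdom c \<inter> cdom d. X d x = jacobian c d x *v X c x)"

definition riemannian_metric :: "'m chart set \<Rightarrow> 'm metric_tensor \<Rightarrow> bool" where
  "riemannian_metric A g \<longleftrightarrow>
     (\<forall>c\<in>A. smooth_on (cmap c ` cdom c) (g c \<circ> cinv c)) \<and>
     (\<forall>c\<in>A. \<forall>x\<in>cdom c. transpose (g c x) = g c x \<and> (\<forall>v. v \<noteq> 0 \<longrightarrow> v \<bullet> (g c x *v v) > 0)) \<and>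
     (\<forall>c\<in>A. \<forall>d\<in>A. \<forall>x\<in>cdom c \<inter> cdom d.
        g c x = transpose (jacobian c d x) ** g d x ** jacobian c d x)"

definition vf_zero_at :: "'m chart set \<Rightarrow> 'm vfield \<Rightarrow> 'm \<Rightarrow> bool" where
  "vf_zero_at A X x \<longleftrightarrow> (\<forall>c\<in>A. x \<in> cdom c \<longrightarrow> X c x = 0)"

definition vf_scaled_at :: "'m chart set \<Rightarrow> 'm vfield \<Rightarrow> real \<Rightarrow> 'm vfield \<Rightarrow> 'm \<Rightarrow> bool" where
  "vf_scaled_at A Y k X x \<longleftrightarrow> (\<forall>c\<in>A. x \<in> cdom c \<longrightarrow> Y c x = k *\<^sub>R X c x)"

section \<open>Vector calculus of a Riemannian metric in positive charts\<close>

definition vol_density :: "'m metric_tensor \<Rightarrow> 'm chart \<Rightarrow> 'm \<Rightarrow> real" where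
  "vol_density g c x = sqrt (det (g c x))"

definition flat :: "'m metric_tensor \<Rightarrow> 'm vfield \<Rightarrow> 'm chart \<Rightarrow> 'm \<Rightarrow> real^3" where
  "flat g X c x = g c x *v X c x"

definition sharp :: "'m metric_tensor \<Rightarrow> ('m chart \<Rightarrow> 'm \<Rightarrow> real^3) \<Rightarrow> 'm vfield" where
  "sharp g a c x = matrix_inv (g c x) *v a c x"

definition grad :: "'m metric_tensor \<Rightarrow> ('m \<Rightarrow> real) \<Rightarrow> 'm vfield" where
  "grad g f = sharp g (\<lambda>c x. \<chi> i. partial c i f x)"

text \<open>The Riemannian volume form \<open>vol\<close> has density \<open>vol_density\<close> in a positive chart.
  The divergence of \<open>X\<close> is the factor by which the Lie derivative along \<open>X\<close> multiplies
  \<open>vol\<close>; the cross product has flat equal to \<open>vol(X, Y, _)\<close>; and contracting \<open>vol\<close> with the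
  curl of \<open>X\<close> gives the exterior derivative of the flat of \<open>X\<close>.\<close>

definition divergence :: "'m metric_tensor \<Rightarrow> 'm vfield \<Rightarrow> 'm chart \<Rightarrow> 'm \<Rightarrow> real" where
  "divergence g X c x =
     (\<Sum>i\<in>UNIV. partial c i (\<lambda>y. vol_density g c y * X c y $ i) x) / vol_density g c x"

definition cross_product :: "'m metric_tensor \<Rightarrow> 'm vfield \<Rightarrow> 'm vfield \<Rightarrow> 'm vfield" where
  "cross_product g X Y = sharp g (\<lambda>c x. vol_density g c x *\<^sub>R cross3 (X c x) (Y c x))"

definition curl :: "'m metric_tensor \<Rightarrow> 'm vfield \<Rightarrow> 'm vfield" where
  "curl g X c x =
     (let D = (\<lambda>i j. partial c i (\<lambda>y. flat g X c y $ j) x)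
      in (1 / vol_density g c x) *\<^sub>R vector [D 2 3 - D 3 2, D 3 1 - D 1 3, D 1 2 - D 2 1])"

text \<open>Components of the outward unit normal at a boundary point, for the Gram matrix \<open>G\<close> of a
  chart there: the boundary is \<open>y $ 3 = 0\<close> and the manifold lies in \<open>y $ 3 \<ge> 0\<close>.\<close>

definition outward_unit_normal :: "real^3^3 \<Rightarrow> real^3" where
  "outward_unit_normal G =
     (THE n. (\<forall>v. v $ 3 = 0 \<longrightarrow> v \<bullet> (G *v n) = 0) \<and> n \<bullet> (G *v n) = 1 \<and> n $ 3 < 0)"

definition mhd_equilibrium ::
    "'m chart set \<Rightarrow> 'm metric_tensor \<Rightarrow> 'm vfield \<Rightarrow> ('m \<Rightarrow> real) \<Rightarrow> bool" where
  "mhd_equilibrium A g B p \<longleftrightarrow>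
     smooth_vector_field A B \<and> smooth_function A p \<and>
     (\<forall>c\<in>A. \<forall>x\<in>cdom c.
        cross_product g (curl g B) B c x = grad g p c x \<and>
        divergence g B c x = 0 \<and>
        (x \<in> boundary_points A \<longrightarrow>
           B c x \<bullet> (g c x *v outward_unit_normal (g c x)) = 0))"

section \<open>Embedded circles and Morse--Bott critical submanifolds\<close>

definition smooth_curve :: "'m::topological_space chart set \<Rightarrow> (real \<Rightarrow> 'm) \<Rightarrow> bool" where
  "smooth_curve A a \<longleftrightarrow>
     continuous_on UNIV a \<and> (\<forall>c\<in>A. smooth_on (a -` cdom c) (cmap c \<circ> a))"

definition velocity :: "'m chart \<Rightarrow> (real \<Rightarrow> 'm) \<Rightarrow> real \<Rightarrow> real^3" where
  "velocity c a t = vector_derivative (cmap c \<circ> a) (at t)"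

text \<open>The image of a smooth embedding \<open>f\<close> of the unit circle. As \<open>cis\<close> is a local
  diffeomorphism onto the circle, \<open>f\<close> is smooth (an immersion) iff \<open>f \<circ> cis\<close> is.\<close>

definition embedded_circle :: "'m::topological_space chart set \<Rightarrow> 'm set \<Rightarrow> bool" where
  "embedded_circle A \<gamma> \<longleftrightarrow>
     (\<exists>f h. homeomorphism (sphere (0::complex) 1) \<gamma> f h \<and>
        smooth_curve A (f \<circ> cis) \<and>
        (\<forall>t. \<forall>c\<in>A. f (cis t) \<in> cdom c \<longrightarrow> velocity c (f \<circ> cis) t \<noteq> 0))"

text \<open>Tangent space at \<open>x\<close> of a submanifold \<open>\<gamma>\<close>, in the coordinates of the chart \<open>c\<close>.\<close>

definition tangent_vectors ::
    "'m::topological_space chart set \<Rightarrow> 'm set \<Rightarrow> 'm chart \<Rightarrow> 'm \<Rightarrow> (real^3) set" where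
  "tangent_vectors A \<gamma> c x =
     {velocity c a 0 | a. smooth_curve A a \<and> range a \<subseteq> \<gamma> \<and> a 0 = x}"

text \<open>The coordinate expression of the Hessian; it is intrinsic at critical points only.\<close>

definition hessian :: "'m chart \<Rightarrow> ('m \<Rightarrow> real) \<Rightarrow> 'm \<Rightarrow> real^3 \<Rightarrow> real^3 \<Rightarrow> real" where
  "hessian c p x u v =
     (\<Sum>i\<in>UNIV. \<Sum>j\<in>UNIV. partial c i (partial c j p) x * u $ i * v $ j)"

definition morse_bott_critical ::
    "'m::topological_space chart set \<Rightarrow> ('m \<Rightarrow> real) \<Rightarrow> 'm set \<Rightarrow> bool" where
  "morse_bott_critical A p \<gamma> \<longleftrightarrow>
     (\<forall>x\<in>\<gamma>. \<forall>c\<in>A. x \<in> cdom c \<longrightarrow>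
        (\<forall>i. partial c i p x = 0) \<and>
        (\<exists>\<pi>. subspace \<pi> \<and> dim \<pi> = 2 \<and>
           {u + v | u v. u \<in> \<pi> \<and> v \<in> tangent_vectors A \<gamma> c x} = UNIV \<and>
           (\<forall>u\<in>\<pi>. (\<forall>v\<in>\<pi>. hessian c p x u v = 0) \<longrightarrow> u = 0)))"

definition locally_maximised_on :: "('m::topological_space \<Rightarrow> real) \<Rightarrow> 'm set \<Rightarrow> bool" where
  "locally_maximised_on p \<gamma> \<longleftrightarrow> (\<forall>x\<in>\<gamma>. \<forall>\<^sub>F y in nhds x. p y \<le> p x)"

definition locally_minimised_on :: "('m::topological_space \<Rightarrow> real) \<Rightarrow> 'm set \<Rightarrow> bool" where
  "locally_minimised_on p \<gamma> \<longleftrightarrow> (\<forall>x\<in>\<gamma>. \<forall>\<^sub>F y in nhds x. p x \<le> p y)"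

end

theory Submission
  imports Defs
begin

text \<open>Multiply \<open>J = curl B\<close> and \<open>B\<close> by the Riemannian volume density to get coordinate fields \<open>X\<close> and
  \<open>Y\<close> that are divergence free in the Euclidean sense and satisfy \<open>X \<times> Y = \<rho> \<nabla>p\<close>. Along the circle
  \<open>\<nabla>p = 0\<close>. There \<open>X\<close> and \<open>Y\<close> lie in the kernel of the Hessian of \<open>p\<close>, which by nondegeneracy is the
  tangent line of the circle, and they have no common zero, as otherwise the Hessian would vanish.
  The Euclidean curl of \<open>X \<times> Y = \<rho> \<nabla>p\<close> vanishes on the circle, which says that \<open>X\<close> and \<open>Y\<close> commute there;
  hence the ratio of these two tangent fields is locally constant wherever it is defined. So
  \<open>B\<close> vanishes everywhere or nowhere on the circle, and in the latter case \<open>J = k B\<close> for a constant \<open>k\<close>.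
  Where \<open>B = 0\<close>, the Laplacian of \<open>p\<close> is \<open>- \<bar>J\<bar>\<^sup>2\<close>, so \<open>p\<close> cannot have a minimum there unless \<open>J = 0\<close>.\<close>

section \<open>Twice differentiable maps\<close>

text \<open>Second derivatives are only asked for at the point itself. This is weaker than C^2, yet
  enough for symmetry of second derivatives, and it depends only on the germ of \<open>f\<close> at
  \<open>x\<close>.\<close>

definition twice_differentiable_at :: "('a::real_normed_vector \<Rightarrow> 'b::real_normed_vector) \<Rightarrow> 'a \<Rightarrow> bool" where
  "twice_differentiable_at f x \<longleftrightarrow>
     (\<forall>\<^sub>F z in nhds x. f differentiable (at z)) \<and>
     (\<forall>v. (\<lambda>z. frechet_derivative f (at z) v) differentiable (at x))"

section \<open>Derivatives depend only on germs\<close>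

lemma has_derivative_cong_nhds:
  assumes "\<forall>\<^sub>F z in nhds x. f z = g z"
  shows "(f has_derivative D) (at x) \<longleftrightarrow> (g has_derivative D) (at x)"
proof -
  have "f x = g x" using assms eventually_nhds_x_imp_x by blast
  moreover have "\<forall>\<^sub>F z in at x. f z = g z"
    using assms by (simp add: eventually_nhds_conv_at)
  ultimately show ?thesis
    by (metis (mono_tags, lifting) UNIV_I eventually_mono has_derivative_transform_eventually)
qed

lemma differentiable_cong_nhds:
  assumes "\<forall>\<^sub>F z in nhds x. f z = g z"
  shows "f differentiable (at x) \<longleftrightarrow> g differentiable (at x)"
  using has_derivative_cong_nhds[OF assms] by (simp add: differentiable_def)

lemmas differentiable_transform_nhds = differentiable_cong_nhds[THEN iffD1]

lemma frechet_derivative_cong_nhds: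
  assumes "\<forall>\<^sub>F z in nhds x. f z = g z"
  shows "frechet_derivative f (at x) = frechet_derivative g (at x)"
  using has_derivative_cong_nhds[OF assms] by (simp add: frechet_derivative_def)

lemma twice_differentiable_at_imp_differentiable:
  "twice_differentiable_at f x \<Longrightarrow> f differentiable (at x)"
  unfolding twice_differentiable_at_def using eventually_nhds_x_imp_x by blast

lemma twice_differentiable_at_cong_nhds:
  assumes "\<forall>\<^sub>F z in nhds x. f z = g z" and "twice_differentiable_at f x"
  shows "twice_differentiable_at g x"
proof -
  \<comment> \<open>Equality near \<open>x\<close> is equality near every nearby point, so the
    derivatives at those points agree as well.\<close>
  have ev: "\<forall>\<^sub>F w in nhds x. \<forall>\<^sub>F z in nhds w. f z = g z"
    using assms(1) by (simp add: eventually_eventually)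
  have "\<forall>\<^sub>F z in nhds x. g differentiable (at z)"
    using assms(2)[unfolded twice_differentiable_at_def, THEN conjunct1] ev
    by eventually_elim (simp add: differentiable_cong_nhds)
  moreover have "(\<lambda>z. frechet_derivative g (at z) v) differentiable (at x)" for v
  proof -
    have "\<forall>\<^sub>F z in nhds x. frechet_derivative f (at z) v = frechet_derivative g (at z) v"
      using ev by eventually_elim (simp add: frechet_derivative_cong_nhds)
    then show ?thesis
      by (rule differentiable_transform_nhds) (use assms(2) in \<open>simp add: twice_differentiable_at_def\<close>)
  qed
  ultimately show ?thesis by (simp add: twice_differentiable_at_def)
qed

text \<open>The product rule writes the derivative near \<open>x\<close> as a sum of products of
  maps differentiable at \<open>x\<close>, to which the product rule applies once more.\<close>

lemma twice_differentiable_at_bilinear: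
  fixes f :: "'a::real_normed_vector \<Rightarrow> 'b::real_normed_vector"
    and g :: "'a \<Rightarrow> 'c::real_normed_vector"
  assumes "bounded_bilinear pr" "twice_differentiable_at f x" "twice_differentiable_at g x"
  shows "twice_differentiable_at (\<lambda>z. pr (f z) (g z)) x"
proof -
  interpret bounded_bilinear pr by fact
  have dd: "(\<lambda>z. pr (F z) (G z)) differentiable (at y)"
    if "F differentiable (at y)" "G differentiable (at y)" for F G and y :: 'a
    using that FDERIV unfolding differentiable_def by blast
  have fr: "frechet_derivative (\<lambda>z. pr (f z) (g z)) (at y) v =
      pr (f y) (frechet_derivative g (at y) v) + pr (frechet_derivative f (at y) v) (g y)"
    if "f differentiable (at y)" "g differentiable (at y)" for y v
    using FDERIV[OF that[unfolded frechet_derivative_works]]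
    by (simp add: frechet_derivative_at[symmetric])
  have ev: "\<forall>\<^sub>F y in nhds x. f differentiable (at y) \<and> g differentiable (at y)"
    using assms by (auto simp: twice_differentiable_at_def eventually_conj_iff)
  have "\<forall>\<^sub>F y in nhds x. (\<lambda>z. pr (f z) (g z)) differentiable (at y)"
    using ev by eventually_elim (rule dd; blast)
  moreover have "(\<lambda>y. frechet_derivative (\<lambda>z. pr (f z) (g z)) (at y) v) differentiable (at x)" for v
  proof -
    have "(\<lambda>y. pr (f y) (frechet_derivative g (at y) v) + pr (frechet_derivative f (at y) v) (g y))
        differentiable (at x)"
      using assms(2,3)[THEN twice_differentiable_at_imp_differentiable] assms(2,3)
      by (intro differentiable_add dd) (simp_all add: twice_differentiable_at_def)
    then show ?thesis
    proof (rule differentiable_transform_nhds[rotated])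
      show "\<forall>\<^sub>F y in nhds x. pr (f y) (frechet_derivative g (at y) v) + pr (frechet_derivative f (at y) v) (g y) =
        frechet_derivative (\<lambda>z. pr (f z) (g z)) (at y) v"
      using ev by eventually_elim (simp add: fr)
    qed
  qed
  ultimately show ?thesis by (simp add: twice_differentiable_at_def)
qed

lemma frechet_derivative_bounded_linear_compose:
  assumes "bounded_linear h" "f differentiable (at y)"
  shows "frechet_derivative (\<lambda>z. h (f z)) (at y) v = h (frechet_derivative f (at y) v)"
  using bounded_linear.has_derivative[OF assms(1) assms(2)[unfolded frechet_derivative_works]]
  by (simp add: frechet_derivative_at[symmetric])

lemma twice_differentiable_at_bounded_linear:
  fixes f :: "'a::real_normed_vector \<Rightarrow> 'b::real_normed_vector"
  assumes "bounded_linear h" "twice_differentiable_at f x"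
  shows "twice_differentiable_at (\<lambda>z. h (f z)) x"
proof -
  have dd: "(\<lambda>z. h (F z)) differentiable (at y)" if "F differentiable (at y)" for F and y :: 'a
    using that bounded_linear.has_derivative[OF assms(1)] unfolding differentiable_def by blast
  have ev: "\<forall>\<^sub>F y in nhds x. f differentiable (at y)"
    using assms by (auto simp: twice_differentiable_at_def)
  have "\<forall>\<^sub>F y in nhds x. (\<lambda>z. h (f z)) differentiable (at y)"
    using ev by eventually_elim (rule dd; blast)
  moreover have "(\<lambda>y. frechet_derivative (\<lambda>z. h (f z)) (at y) v) differentiable (at x)" for v
  proof -
    have "(\<lambda>y. h (frechet_derivative f (at y) v)) differentiable (at x)"
      using assms by (intro dd) (auto simp: twice_differentiable_at_def)
    then show ?thesis
    proof (rule differentiable_transform_nhds[rotated])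
      show "\<forall>\<^sub>F y in nhds x. h (frechet_derivative f (at y) v) =
        frechet_derivative (\<lambda>z. h (f z)) (at y) v"
      using ev by eventually_elim (simp add: frechet_derivative_bounded_linear_compose assms)
    qed
  qed
  ultimately show ?thesis by (simp add: twice_differentiable_at_def)
qed

text \<open>The mean value theorem in direction \<open>u\<close> turns the second difference into
  \<open>h\<close> times an increment of the derivative along \<open>u\<close>; differentiability of
  that derivative at \<open>x\<close> then yields the term in \<open>v\<close>. The limit treats
  \<open>u\<close> and \<open>v\<close> differently although the second difference does not.\<close>

lemma second_difference_estimate:
  fixes f :: "'a::real_normed_vector \<Rightarrow> real" and u v :: 'a
  assumes "twice_differentiable_at f x" and "e > 0"
  defines "L \<equiv> frechet_derivative (\<lambda>z. frechet_derivative f (at z) u) (at x)"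
  shows "\<forall>\<^sub>F h in at_right 0.
    \<bar>f (x + h *\<^sub>R u + h *\<^sub>R v) - f (x + h *\<^sub>R u) - f (x + h *\<^sub>R v) + f x - h\<^sup>2 * L v\<bar> \<le> e * h\<^sup>2"
proof -
  define g where "g = (\<lambda>z. frechet_derivative f (at z) u)"
  define K where "K = 1 + norm u + norm v"
  have K: "K > 0" by (simp add: K_def add_pos_nonneg)
  \<comment> \<open>\<open>h * K\<close> bounds all displacements that occur; the two errors
    \<open>e' * (h * K)\<close> below add up to \<open>e * h\<close>.\<close>
  define e' where "e' = e / (2 * K)"
  have e': "e' > 0" using assms K by (simp add: e'_def)
  have gL: "(g has_derivative L) (at x)"
    using assms(1) unfolding twice_differentiable_at_def g_def L_def
    by (simp add: frechet_derivative_works[symmetric])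
  then interpret L: linear L by (rule has_derivative_linear)
  obtain d1 where d1: "d1 > 0" "\<And>y. norm (y - x) < d1 \<Longrightarrow> norm (g y - g x - L (y - x)) \<le> e' * norm (y - x)"
    using gL e' unfolding has_derivative_at_alt by blast
  obtain d2 where d2: "d2 > 0" "\<And>y. dist y x < d2 \<Longrightarrow> f differentiable (at y)"
    using assms(1) unfolding twice_differentiable_at_def eventually_nhds_metric by blast
  define d where "d = min d1 d2 / K"
  have d: "d > 0" using d1 d2 K by (simp add: d_def)
  have "\<bar>f (x + h *\<^sub>R u + h *\<^sub>R v) - f (x + h *\<^sub>R u) - f (x + h *\<^sub>R v) + f x - h\<^sup>2 * L v\<bar> \<le> e * h\<^sup>2"
    if h: "0 < h" "h < d" for h
  proof -
    have hK: "h * K < min d1 d2"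
      using h K by (simp add: d_def field_simps)
    have small: "norm (t *\<^sub>R u + s *\<^sub>R v) \<le> h * K" if "0 \<le> t" "t \<le> h" "0 \<le> s" "s \<le> h" for t s
    proof -
      have "norm (t *\<^sub>R u + s *\<^sub>R v) \<le> t * norm u + s * norm v"
        using norm_triangle_ineq[of "t *\<^sub>R u" "s *\<^sub>R v"] that by simp
      also have "\<dots> \<le> h * norm u + h * norm v"
        using that by (intro add_mono mult_right_mono) auto
      also have "\<dots> \<le> h * K" using h by (simp add: K_def algebra_simps)
      finally show ?thesis .
    qed
    have der: "((\<lambda>\<tau>. f (x + \<tau> *\<^sub>R u + s *\<^sub>R v)) has_real_derivative g (x + \<tau> *\<^sub>R u + s *\<^sub>R v)) (at \<tau>)"
      if "0 \<le> \<tau>" "\<tau> \<le> h" "0 \<le> s" "s \<le> h" for \<tau> s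
    proof -
      have "norm (\<tau> *\<^sub>R u + s *\<^sub>R v) < d2"
        using small[OF that] hK by linarith
      then have "f differentiable (at (x + \<tau> *\<^sub>R u + s *\<^sub>R v))"
        by (intro d2(2)) (simp add: dist_norm add.assoc)
      then have fd: "(f has_derivative frechet_derivative f (at (x + \<tau> *\<^sub>R u + s *\<^sub>R v)))
          (at (x + \<tau> *\<^sub>R u + s *\<^sub>R v))"
        by (simp add: frechet_derivative_works[symmetric])
      then interpret F: linear "frechet_derivative f (at (x + \<tau> *\<^sub>R u + s *\<^sub>R v))"
        by (rule has_derivative_linear)
      have "((\<lambda>\<tau>. x + \<tau> *\<^sub>R u + s *\<^sub>R v) has_derivative (\<lambda>t. t *\<^sub>R u)) (at \<tau>)"
        by (auto intro!: derivative_eq_intros)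
      from has_derivative_compose[OF this fd] show ?thesis
        unfolding has_field_derivative_def g_def by (simp add: F.scaleR mult_commute_abs)
    qed
    \<comment> \<open>The mean value theorem is applied to the difference of \<open>f\<close> along
      two parallel segments, so that both increments share the same \<open>z\<close>. The summands
      with factor 0 bring all four points into the form that \<open>der\<close> expects.\<close>
    have "\<exists>z>0. z < h \<and> (f (x + h *\<^sub>R u + h *\<^sub>R v) - f (x + h *\<^sub>R u + 0 *\<^sub>R v)) -
        (f (x + 0 *\<^sub>R u + h *\<^sub>R v) - f (x + 0 *\<^sub>R u + 0 *\<^sub>R v))
        = (h - 0) * (g (x + z *\<^sub>R u + h *\<^sub>R v) - g (x + z *\<^sub>R u + 0 *\<^sub>R v))"
      using h by (intro MVT2 DERIV_diff der) auto
    then obtain z where z: "0 < z" "z < h"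
      "f (x + h *\<^sub>R u + h *\<^sub>R v) - f (x + h *\<^sub>R u) - f (x + h *\<^sub>R v) + f x
        = h * (g (x + z *\<^sub>R u + h *\<^sub>R v) - g (x + z *\<^sub>R u))"
      by auto
    have est: "\<bar>g (x + z *\<^sub>R u + s *\<^sub>R v) - g x - L (z *\<^sub>R u + s *\<^sub>R v)\<bar> \<le> e' * (h * K)"
      if "0 \<le> s" "s \<le> h" for s
    proof -
      have sm: "norm (z *\<^sub>R u + s *\<^sub>R v) \<le> h * K" using small that z by simp
      then have "norm (g (x + z *\<^sub>R u + s *\<^sub>R v) - g x - L (z *\<^sub>R u + s *\<^sub>R v))
          \<le> e' * norm (z *\<^sub>R u + s *\<^sub>R v)"
        using d1(2)[of "x + z *\<^sub>R u + s *\<^sub>R v"] hK by (simp add: add.assoc)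
      also have "\<dots> \<le> e' * (h * K)" using sm e' by simp
      finally show ?thesis by simp
    qed
    \<comment> \<open>The unknown \<open>z\<close> occurs in both linear approximations and cancels
      in their difference.\<close>
    have "L (z *\<^sub>R u + h *\<^sub>R v) = L (z *\<^sub>R u + 0 *\<^sub>R v) + h * L v"
      by (simp add: L.add L.scaleR)
    then have "\<bar>g (x + z *\<^sub>R u + h *\<^sub>R v) - g (x + z *\<^sub>R u) - h * L v\<bar> \<le> 2 * e' * (h * K)"
      using est[of h] est[of 0] h by simp
    also have "\<dots> = e * h" using K by (simp add: e'_def)
    finally have "h * \<bar>g (x + z *\<^sub>R u + h *\<^sub>R v) - g (x + z *\<^sub>R u) - h * L v\<bar> \<le> h * (e * h)"
      using h by simp
    then have "\<bar>h * (g (x + z *\<^sub>R u + h *\<^sub>R v) - g (x + z *\<^sub>R u) - h * L v)\<bar> \<le> h * (e * h)"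
      using h by (simp add: abs_mult)
    then show ?thesis
      unfolding z(3) by (simp add: algebra_simps power2_eq_square)
  qed
  then show ?thesis using d by (auto simp: eventually_at_right_field)
qed

text \<open>One and the same second difference, divided by \<open>h\<^sup>2\<close>, approximates
  both sides.\<close>

lemma second_derivative_symmetric:
  fixes f :: "'a::real_normed_vector \<Rightarrow> real" and u v :: 'a
  assumes "twice_differentiable_at f x"
  shows "frechet_derivative (\<lambda>z. frechet_derivative f (at z) u) (at x) v =
    frechet_derivative (\<lambda>z. frechet_derivative f (at z) v) (at x) u" (is "?L = ?R")
proof -
  have "\<bar>?L - ?R\<bar> \<le> 0 + e" if "e > 0" for e
  proof -
    have e2: "e / 2 > 0" using that by simp
    have pos: "\<forall>\<^sub>F h in at_right 0. (0::real) < h"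
      by (rule eventually_at_right_less)
    have "\<forall>\<^sub>F h in at_right (0::real). h > 0 \<and> \<bar>?L - ?R\<bar> \<le> e"
      using second_difference_estimate[OF assms e2, of u v]
        second_difference_estimate[OF assms e2, of v u]
        pos
    proof eventually_elim
      case (elim h)
      have "f (x + h *\<^sub>R v + h *\<^sub>R u) = f (x + h *\<^sub>R u + h *\<^sub>R v)"
        by (simp add: add_ac)
      moreover have "e / 2 * h\<^sup>2 = e * h\<^sup>2 / 2"
        by simp
      ultimately have "\<bar>h\<^sup>2 * ?L - h\<^sup>2 * ?R\<bar> \<le> e * h\<^sup>2"
        using elim by linarith
      then have "h\<^sup>2 * \<bar>?L - ?R\<bar> \<le> h\<^sup>2 * e"
        by (simp add: abs_mult right_diff_distrib[symmetric] mult.commute)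
      then show "h > 0 \<and> \<bar>?L - ?R\<bar> \<le> e" using elim by simp
    qed
    then show ?thesis
      using eventually_happens' [OF trivial_limit_at_right_real] by fastforce
  qed
  then have "\<bar>?L - ?R\<bar> \<le> 0" by (rule field_le_epsilon)
  then show ?thesis by simp
qed

section \<open>From smoothness to two derivatives at interior points\<close>

lemma C_k_on_imp_twice_differentiable_at:
  assumes "C_k_on 2 W f" "open W" "x \<in> W"
  shows "twice_differentiable_at f x"
  using assms eventually_nhds_in_open[of W x]
  by (auto simp: twice_differentiable_at_def numeral_2_eq_2 elim!: eventually_mono)

lemma smooth_on_imp_twice_differentiable_at:
  assumes "smooth_on S f" "x \<in> interior S"
  shows "twice_differentiable_at f x"
proof -
  have "x \<in> S" using assms(2) interior_subset by blast
  then obtain W F where WF: "open W" "x \<in> W" "C_k_on 2 W F" "\<forall>y\<in>S \<inter> W. F y = f y"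
    using assms(1) unfolding smooth_on_def by blast
  have "\<forall>\<^sub>F y in nhds x. y \<in> interior S \<inter> W"
    using WF assms(2) by (intro eventually_nhds_in_open) auto
  then have "\<forall>\<^sub>F y in nhds x. F y = f y"
    using WF(4) interior_subset by (fastforce elim: eventually_mono)
  then show ?thesis
    using C_k_on_imp_twice_differentiable_at[OF WF(3,1,2)] twice_differentiable_at_cong_nhds by blast
qed

section \<open>Linear algebra and curves in \<open>\<real>\<^sup>3\<close>\<close>

text \<open>This is the axial vector of the antisymmetric part. If \<open>N $ j $ i\<close> is the
  \<open>i\<close>-th partial derivative of the \<open>j\<close>-th component of a field, it is the
  Euclidean curl.\<close>

definition axial :: "real^3^3 \<Rightarrow> real^3" where
  "axial N = vector [N$3$2 - N$2$3, N$1$3 - N$3$1, N$2$1 - N$1$2]"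

lemma cross3_axial: "cross3 (axial N) v = (N - transpose N) *v v"
  by (simp add: axial_def cross3_def vec_eq_iff forall_3 matrix_vector_mult_def sum_3 transpose_def
      algebra_simps)

text \<open>Only the antisymmetric part counts; in a change of charts this removes the second
  derivatives of the transition map from the curl.\<close>

lemma axial_add_symmetric:
  assumes "transpose S = S"
  shows "axial (M + S) = axial M"
proof -
  have s: "S$i$j = S$j$i" for i j
    using arg_cong[OF assms, of "\<lambda>M. M$j$i"] by (simp add: transpose_def)
  show ?thesis
    by (simp add: axial_def s[of 3 2] s[of 1 3] s[of 2 1])
qed

text \<open>A polynomial identity in the entries: antisymmetric forms in dimension three transform
  like vector densities.\<close>

lemma axial_congruence: "P *v axial (transpose P ** M ** P) = det P *\<^sub>R axial M"
  unfolding vec_eq_iff forall_3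
  by (simp add: axial_def matrix_matrix_mult_def matrix_vector_mult_def sum_3 transpose_def det_3
      algebra_simps)

lemma linear_expand_3:
  fixes f :: "real^3 \<Rightarrow> 'b::real_vector"
  assumes "linear f"
  shows "f v = v$1 *\<^sub>R f (axis 1 1) + v$2 *\<^sub>R f (axis 2 1) + v$3 *\<^sub>R f (axis 3 1)"
proof -
  interpret linear f by fact
  have "v = v$1 *\<^sub>R axis 1 1 + v$2 *\<^sub>R axis 2 1 + v$3 *\<^sub>R axis 3 1"
    by (simp add: vec_eq_iff forall_3 axis_def)
  then have "f v = f (v$1 *\<^sub>R axis 1 1 + v$2 *\<^sub>R axis 2 1 + v$3 *\<^sub>R axis 3 1)"
    by simp
  then show ?thesis by (simp add: add scaleR)
qed

text \<open>This is the pointwise form of curl (X x Y) = X div Y - Y div X + DX(Y) - DY(X). Here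
  \<open>a\<close>, \<open>b\<close> are the values of the fields and \<open>X\<close>,
  \<open>Y\<close> their derivatives; the divergences vanish, and the left side vanishes since it is
  the axial vector of a symmetric matrix.\<close>

lemma solenoidal_commute:
  fixes X Y H :: "real^3 \<Rightarrow> real^3"
  assumes "linear X" "linear Y"
    and tr: "(\<Sum>i\<in>UNIV. X (axis i 1) $ i) = 0" "(\<Sum>i\<in>UNIV. Y (axis i 1) $ i) = 0"
    and H: "\<And>v. cross3 (X v) b + cross3 a (Y v) = r *\<^sub>R H v"
    and sym: "\<And>i j. H (axis i 1) $ j = H (axis j 1) $ i"
  shows "X b = Y a"
proof -
  have eq: "(cross3 (X (axis i 1)) b + cross3 a (Y (axis i 1))) $ j =
      (cross3 (X (axis j 1)) b + cross3 a (Y (axis j 1))) $ i" for i j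
    unfolding H using sym by simp
  \<comment> \<open>The traces eliminate one diagonal entry of each derivative; the claim then
    follows linearly from the three antisymmetric components of \<open>eq\<close>.\<close>
  have xt: "X (axis 1 1) $ 1 = - X (axis 2 1) $ 2 - X (axis 3 1) $ 3"
    and yt: "Y (axis 1 1) $ 1 = - Y (axis 2 1) $ 2 - Y (axis 3 1) $ 3"
    using tr unfolding sum_3 by linarith+
  have "X b = b$1 *\<^sub>R X (axis 1 1) + b$2 *\<^sub>R X (axis 2 1) + b$3 *\<^sub>R X (axis 3 1)"
    "Y a = a$1 *\<^sub>R Y (axis 1 1) + a$2 *\<^sub>R Y (axis 2 1) + a$3 *\<^sub>R Y (axis 3 1)"
    by (rule linear_expand_3[OF assms(1)], rule linear_expand_3[OF assms(2)])
  then show ?thesis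
    using eq[of 1 2] eq[of 2 3] eq[of 3 1]
    by (simp add: vec_eq_iff forall_3 cross3_def xt yt algebra_simps)
qed

section \<open>Positive definite matrices and orthonormal frames\<close>

lemma gram_schmidt_3:
  fixes G :: "real^3^3"
  assumes sym: "transpose G = G" and pos: "\<And>v. v \<noteq> 0 \<Longrightarrow> v \<bullet> (G *v v) > 0"
  obtains Q :: "real^3^3" where "transpose Q ** G ** Q = mat 1"
proof -
  define b where "b = (\<lambda>u v. u \<bullet> (G *v v))"
  have b_sym: "b u v = b v u" for u v
    unfolding b_def by (metis dot_lmul_matrix inner_commute sym transpose_matrix_vector)
  have b_lin: "b (u - k *\<^sub>R w) v = b u v - k * b w v" "b (k *\<^sub>R u) v = k * b u v"
    "b v (k *\<^sub>R u) = k * b v u" for u v w k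
    by (simp_all add: b_def inner_diff_left matrix_vector_mult_scaleR)
  define nrm where "nrm = (\<lambda>v. (1 / sqrt (b v v)) *\<^sub>R v)"
  have b_pos: "b v v > 0" if "v \<noteq> 0" for v using pos that by (simp add: b_def)
  have nrm: "b (nrm v) (nrm v) = 1" if "v \<noteq> 0" for v
    using b_pos[OF that] by (simp add: nrm_def b_lin real_div_sqrt field_simps flip: power2_eq_square)
  have nrm0: "b (nrm v) w = 0" if "b v w = 0" for v w
    using that by (simp add: nrm_def b_lin)
  define q1 where "q1 = nrm (axis 1 1)"
  define v2 where "v2 = axis 2 1 - b (axis 2 1) q1 *\<^sub>R q1"
  define q2 where "q2 = nrm v2"
  define v3 where "v3 = axis 3 1 - b (axis 3 1) q1 *\<^sub>R q1 - b (axis 3 1) q2 *\<^sub>R q2"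
  define q3 where "q3 = nrm v3"
  \<comment> \<open>The frame is triangular: \<open>v2\<close> and \<open>v3\<close> keep the
    coordinate 1 of the axis vector they start from, hence are nonzero and can be
    normalised.\<close>
  have q1: "q1$2 = 0" "q1$3 = 0" by (simp_all add: q1_def nrm_def axis_def)
  have v2: "v2$2 = 1" "v2$3 = 0" by (simp_all add: v2_def q1 axis_def)
  then have q2: "q2$3 = 0" by (simp add: q2_def nrm_def)
  have v3: "v3$3 = 1" by (simp add: v3_def q1 q2 axis_def)
  have "v2 \<noteq> 0" "v3 \<noteq> 0" "axis 1 1 \<noteq> (0::real^3)"
    using v2 v3 by (auto simp: axis_eq_0_iff)
  then have n: "b q1 q1 = 1" "b q2 q2 = 1" "b q3 q3 = 1"
    by (simp_all add: q1_def q2_def q3_def nrm)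
  have o21: "b q2 q1 = 0" unfolding q2_def by (rule nrm0) (simp add: v2_def b_lin n)
  then have o12: "b q1 q2 = 0" using b_sym by metis
  have o31: "b q3 q1 = 0" "b q3 q2 = 0"
    unfolding q3_def by (rule nrm0, simp add: v3_def b_lin n o12 o21)+
  then have o13: "b q1 q3 = 0" "b q2 q3 = 0" using b_sym by metis+
  define Q :: "real^3^3" where "Q = transpose (vector [q1, q2, q3])"
  have ent: "(transpose Q ** G ** Q) $ i $ j = b (column i Q) (column j Q)" for i j
    by (simp add: b_def matrix_matrix_mult_def matrix_vector_mult_def transpose_def column_def
        inner_vec_def sum_3 algebra_simps)
  have col: "column 1 Q = q1" "column 2 Q = q2" "column 3 Q = q3"
    unfolding Q_def column_transpose by (simp_all add: row_def)
  have "transpose Q ** G ** Q = mat 1"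
    unfolding vec_eq_iff forall_3 ent by (simp add: col mat_def n o21 o12 o31 o13)
  then show ?thesis by (rule that)
qed

lemma det_pos_if_positive_definite:
  fixes G :: "real^3^3"
  assumes "transpose G = G" "\<And>v. v \<noteq> 0 \<Longrightarrow> v \<bullet> (G *v v) > 0"
  shows "det G > 0"
proof -
  obtain Q :: "real^3^3" where "transpose Q ** G ** Q = mat 1" using gram_schmidt_3[OF assms] .
  then have "det (transpose Q ** G ** Q) = 1" by simp
  then have "(det Q)\<^sup>2 * det G = 1" by (simp add: det_mul power2_eq_square mult_ac)
  then show ?thesis by (metis zero_less_mult_pos zero_less_one zero_le_power2 zero_less_power2 mult_zero_left zero_neq_one power2_eq_square)
qed

text \<open>With \<open>N = G L\<close> and \<open>M = Q\<^sup>T N Q\<close> for a \<open>G\<close>-orthonormal frame \<open>Q\<close>, the \<open>G\<close>-trace of the form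
  in the hypothesis is \<open>tr ((M - M\<^sup>T) M)\<close>, a negative multiple of the squared norm of
  \<open>M - M\<^sup>T\<close>.\<close>

lemma axial_zero_if_cross_nonneg:
  fixes G L :: "real^3^3"
  assumes G: "transpose G = G" "\<And>v. v \<noteq> 0 \<Longrightarrow> v \<bullet> (G *v v) > 0"
    and nonneg: "\<And>u. 0 \<le> cross3 (axial (G ** L)) (L *v u) \<bullet> u"
  shows "axial (G ** L) = 0"
proof -
  define N where "N = G ** L"
  obtain Q :: "real^3^3" where Q: "transpose Q ** G ** Q = mat 1" using gram_schmidt_3[OF G] .
  \<comment> \<open>A one-sided inverse of a square matrix is two-sided. This recovers
    \<open>L\<close> from \<open>N\<close> and later shows that \<open>Q\<close> is
    invertible.\<close>
  then have Q': "Q ** (transpose Q ** G) = mat 1"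
    using matrix_left_right_inverse by blast
  define M where "M = transpose Q ** N ** Q"
  have L: "L = Q ** (transpose Q ** N)"
    using Q' by (metis N_def matrix_mul_assoc matrix_mul_lid)
  have "A ** (B - C) = A ** B - A ** C" "(B - C) ** A = B ** A - C ** A" for A B C :: "real^3^3"
    by (simp_all add: vec_eq_iff matrix_matrix_mult_def sum_subtractf algebra_simps)
  then have MT: "M - transpose M = transpose Q ** (N - transpose N) ** Q"
    by (simp add: M_def matrix_transpose_mul matrix_mul_assoc)
  \<comment> \<open>The \<open>i\<close>-th diagonal entry is the value of the given form at the
    \<open>i\<close>-th frame vector.\<close>
  have "0 \<le> ((M - transpose M) ** M) $ i $ i" for i
  proof -
    define u where "u = Q *v axis i 1"
    have "L *v u = Q *v (M *v axis i 1)"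
      by (simp add: L M_def u_def matrix_vector_mul_assoc matrix_mul_assoc)
    then have "cross3 (axial N) (L *v u) \<bullet> u =
        ((N - transpose N) *v (Q *v (M *v axis i 1))) \<bullet> (Q *v axis i 1)"
      by (simp add: cross3_axial u_def)
    also have "\<dots> = (transpose Q *v ((N - transpose N) *v (Q *v (M *v axis i 1)))) \<bullet> axis i 1"
      by (metis dot_lmul_matrix transpose_matrix_vector transpose_transpose)
    also have "\<dots> = (((M - transpose M) ** M) *v axis i 1) \<bullet> axis i 1"
      unfolding MT by (simp add: matrix_vector_mul_assoc matrix_mul_assoc)
    also have "\<dots> = ((M - transpose M) ** M) $ i $ i"
      by (simp add: matrix_vector_mult_basis column_def inner_axis)
    finally show ?thesis using nonneg[of u] by (simp add: N_def)
  qed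
  then have "0 \<le> (\<Sum>i\<in>UNIV. ((M - transpose M) ** M) $ i $ i)" by (simp add: sum_nonneg)
  also have "\<dots> = - ((M$1$2 - M$2$1)\<^sup>2 + (M$1$3 - M$3$1)\<^sup>2 + (M$2$3 - M$3$2)\<^sup>2)"
    by (simp add: sum_3 matrix_matrix_mult_def transpose_def power2_eq_square algebra_simps)
  finally have "M$1$2 - M$2$1 = 0" "M$1$3 - M$3$1 = 0" "M$2$3 - M$3$2 = 0"
    using sum_power2_le_zero_iff by (smt (verit) zero_le_power2 zero_eq_power2)+
  then have "axial M = 0" by (simp add: axial_def vec_eq_iff forall_3)
  then have "det Q *\<^sub>R axial N = 0"
    using axial_congruence[of Q N] by (simp add: M_def)
  moreover have "det Q \<noteq> 0"
    using Q' by (metis det_I det_mul mult_zero_left zero_neq_one)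
  ultimately show ?thesis by (simp add: N_def)
qed

text \<open>The vector \<open>v\<close> lies outside the plane, so the two span the space;
  subtracting the right multiple of \<open>v\<close> from \<open>w\<close> lands in the plane and in
  \<open>K\<close>, hence at 0.\<close>

lemma kernel_spanned_if_nondegenerate:
  fixes v w :: "real^3"
  assumes \<pi>: "subspace \<pi>" "dim \<pi> = 2" and "subspace K" "v \<in> K" "w \<in> K" "v \<noteq> 0"
    and triv: "\<And>u. u \<in> \<pi> \<Longrightarrow> u \<in> K \<Longrightarrow> u = 0"
  obtains k where "w = k *\<^sub>R v"
proof -
  have "v \<notin> span \<pi>" using triv assms by (metis span_eq_iff)
  then have "dim (insert v \<pi>) = 3" using \<pi> by (simp add: dim_insert)
  then have "span (insert v \<pi>) = UNIV"
    using dim_eq_full[of "insert v \<pi>"] by simp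
  then obtain k where "w - k *\<^sub>R v \<in> span \<pi>" using span_breakdown_eq by blast
  moreover have "w - k *\<^sub>R v \<in> K"
    using assms by (simp add: subspace_diff subspace_scale)
  ultimately have "w - k *\<^sub>R v = 0" using triv \<pi> by (metis span_eq_iff)
  then show ?thesis using that[of k] by simp
qed

text \<open>By the quotient rule the relation between \<open>x'\<close> and \<open>y'\<close> says
  that the ratio of \<open>x\<close> and \<open>y\<close> along their common direction
  \<open>v\<close> has derivative zero.\<close>

lemma locally_constant_ratio:
  fixes x y v x' y' :: "real \<Rightarrow> real^'n"
  assumes ev: "\<forall>\<^sub>F t in nhds t0. (x has_vector_derivative x' t) (at t) \<and>
      (y has_vector_derivative y' t) (at t) \<and>
      (\<exists>\<xi> \<eta>. x t = \<xi> *\<^sub>R v t \<and> y t = \<eta> *\<^sub>R v t \<and> \<xi> *\<^sub>R y' t = \<eta> *\<^sub>R x' t)"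
    and "y t0 \<noteq> 0"
  obtains k where "\<forall>\<^sub>F t in nhds t0. y t \<noteq> 0 \<and> x t = k *\<^sub>R y t"
proof -
  \<comment> \<open>A component in which \<open>y t0\<close> is nonzero serves as denominator near
    \<open>t0\<close>.\<close>
  obtain i where i: "y t0 $ i \<noteq> 0" using assms(2) by (auto simp: vec_eq_iff)
  have "(y has_vector_derivative y' t0) (at t0)"
    using eventually_nhds_x_imp_x[OF ev] by blast
  then have "isCont y t0" by (rule has_vector_derivative_continuous)
  then have "isCont (\<lambda>t. y t $ i) t0" by (intro continuous_intros)
  then have "\<forall>\<^sub>F t in nhds t0. y t $ i \<noteq> 0"
    using i by (simp add: continuous_at tendsto_imp_eventually_ne eventually_nhds_conv_at)
  from eventually_conj[OF this ev] obtain d where d: "d > 0" and D: "\<forall>t. dist t t0 < d \<longrightarrow>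
      y t $ i \<noteq> 0 \<and> (x has_vector_derivative x' t) (at t) \<and> (y has_vector_derivative y' t) (at t) \<and>
      (\<exists>\<xi> \<eta>. x t = \<xi> *\<^sub>R v t \<and> y t = \<eta> *\<^sub>R v t \<and> \<xi> *\<^sub>R y' t = \<eta> *\<^sub>R x' t)"
    unfolding eventually_nhds_metric by (elim exE conjE) (rule that)
  have yi: "y t $ i \<noteq> 0" and xd: "(x has_vector_derivative x' t) (at t)"
    and yd: "(y has_vector_derivative y' t) (at t)"
    and par: "\<exists>\<xi> \<eta>. x t = \<xi> *\<^sub>R v t \<and> y t = \<eta> *\<^sub>R v t \<and> \<xi> *\<^sub>R y' t = \<eta> *\<^sub>R x' t"
    if "dist t t0 < d" for t
    using D that by simp_all
  define r where "r = (\<lambda>t. x t $ i / y t $ i)"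
  have r0: "(r has_real_derivative 0) (at t)" if t: "dist t t0 < d" for t
  proof -
    obtain \<xi> \<eta> where e: "x t = \<xi> *\<^sub>R v t" "y t = \<eta> *\<^sub>R v t" "\<xi> *\<^sub>R y' t = \<eta> *\<^sub>R x' t"
      using par[OF t] by blast
    have "((\<lambda>t. x t $ i) has_real_derivative x' t $ i) (at t)"
      "((\<lambda>t. y t $ i) has_real_derivative y' t $ i) (at t)"
      unfolding has_real_derivative_iff_has_vector_derivative
      using xd[OF t] yd[OF t]
      by (auto intro: bounded_linear.has_vector_derivative[OF bounded_linear_vec_nth])
    from DERIV_divide[OF this] yi[OF t]
    have "(r has_real_derivative (x' t $ i * y t $ i - x t $ i * y' t $ i) / (y t $ i * y t $ i)) (at t)"
      by (simp add: r_def)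
    moreover have "\<xi> * y' t $ i = \<eta> * x' t $ i"
      using e(3) by (metis vector_scaleR_component real_scaleR_def)
    \<comment> \<open>The numerator is
      \<open>(\<eta> * x' t $ i - \<xi> * y' t $ i) * v t $ i\<close>.\<close>
    then have "x' t $ i * y t $ i - x t $ i * y' t $ i = 0"
      using e(1,2) by simp
    ultimately show ?thesis by simp
  qed
  have "r t = r t0" if "dist t t0 < d" for t
  proof -
    have "\<exists>c. \<forall>t\<in>ball t0 d. r t = c"
      by (intro has_field_derivative_zero_constant has_field_derivative_at_within[OF r0])
        (auto simp: dist_commute)
    then show ?thesis using that d by (auto simp: dist_commute)
  qed
  moreover have "x t = r t *\<^sub>R y t" if t: "dist t t0 < d" for t
  proof -
    obtain \<xi> \<eta> where e: "x t = \<xi> *\<^sub>R v t" "y t = \<eta> *\<^sub>R v t" using par[OF t] by blast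
    \<comment> \<open>Hence the ratio of the chosen components is \<open>\<xi> / \<eta>\<close>, the
      ratio of the whole vectors.\<close>
    then have "\<eta> \<noteq> 0" "v t $ i \<noteq> 0" using yi[OF t] by auto
    then show ?thesis using e by (simp add: r_def)
  qed
  ultimately have "\<forall>t. dist t t0 < d \<longrightarrow> y t \<noteq> 0 \<and> x t = r t0 *\<^sub>R y t"
    using yi by (metis zero_index)
  then show ?thesis using that[of "r t0"] d unfolding eventually_nhds_metric by blast
qed

text \<open>A negative \<open>h\<close> would make \<open>\<phi>'\<close> negative just to the right
  of 0, and the mean value theorem would push \<open>\<phi>\<close> below its minimum.\<close>

lemma second_derivative_nonneg_at_local_min:
  fixes \<phi> \<phi>' :: "real \<Rightarrow> real"
  assumes der: "\<forall>\<^sub>F s in nhds 0. (\<phi> has_real_derivative \<phi>' s) (at s)"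
    and h: "(\<phi>' has_real_derivative h) (at 0)" and "\<phi>' 0 = 0"
    and min: "\<forall>\<^sub>F s in nhds 0. \<phi> 0 \<le> \<phi> s"
  shows "0 \<le> h"
proof (rule ccontr)
  assume "\<not> 0 \<le> h"
  then obtain d1 where d1: "d1 > 0" "\<And>s. 0 < s \<Longrightarrow> s < d1 \<Longrightarrow> \<phi>' s < 0"
    using DERIV_neg_dec_right[OF h] \<open>\<phi>' 0 = 0\<close> by auto
  obtain d2 where d2: "d2 > 0" "\<And>s. dist s 0 < d2 \<Longrightarrow> (\<phi> has_real_derivative \<phi>' s) (at s) \<and> \<phi> 0 \<le> \<phi> s"
    using eventually_conj[OF der min] unfolding eventually_nhds_metric by blast
  define s where "s = min d1 d2 / 2"
  have s: "0 < s" "s < d1" "s < d2" using d1 d2 by (auto simp: s_def)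
  obtain z where z: "0 < z" "z < s" "\<phi> s - \<phi> 0 = (s - 0) * \<phi>' z"
    using MVT2[of 0 s \<phi> \<phi>'] s d2(2) by (auto simp: dist_norm)
  then have "\<phi> s - \<phi> 0 < 0" using s d1(2)[of z] by (simp add: mult_pos_neg)
  then show False using d2(2)[of s] s by (simp add: dist_norm)
qed

section \<open>Equilibria in an interior chart\<close>

lemma bounded_bilinear_cross3: "bounded_bilinear cross3"
  using bilinear_cross by (simp add: bilinear_conv_bounded_bilinear)

lemma bounded_bilinear_matrix_vector: "bounded_bilinear ((*v) :: real^3^3 \<Rightarrow> real^3 \<Rightarrow> real^3)"
  unfolding bilinear_conv_bounded_bilinear[symmetric] bilinear_def
  by (auto intro!: linearI simp: vec_eq_iff forall_3 matrix_vector_mult_def sum_3 algebra_simps)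

lemma differentiable_vecI:
  fixes F :: "'a::real_normed_vector \<Rightarrow> real^'n"
  assumes "\<And>j. (\<lambda>z. F z $ j) differentiable (at y)"
  shows "F differentiable (at y)"
  by (rule differentiable_componentwise_within[THEN iffD2])
    (use assms in \<open>auto simp: Basis_vec_def inner_axis\<close>)

lemma differentiable_vec_nth:
  fixes F :: "'a::real_normed_vector \<Rightarrow> 'b::real_normed_vector^'n"
  assumes "F differentiable (at y)"
  shows "(\<lambda>z. F z $ j) differentiable (at y)"
  using bounded_linear.has_derivative[OF bounded_linear_vec_nth assms[unfolded frechet_derivative_works]]
  by (rule differentiableI)

lemma frechet_derivative_vec_nth:
  fixes F :: "'a::real_normed_vector \<Rightarrow> real^'n"
  assumes "F differentiable (at y)"
  shows "frechet_derivative (\<lambda>z. F z $ j) (at y) v = frechet_derivative F (at y) v $ j"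
  using frechet_derivative_bounded_linear_compose[OF bounded_linear_vec_nth assms] .

section \<open>Charts at interior points\<close>

lemma homeomorphism_chart:
  assumes "is_chart c"
  shows "homeomorphism (cdom c) (cmap c ` cdom c) (cmap c) (cinv c)"
  using assms by (simp add: is_chart_def)

lemma cinv_cmap: "is_chart c \<Longrightarrow> x \<in> cdom c \<Longrightarrow> cinv c (cmap c x) = x"
  by (rule homeomorphism_apply1[OF homeomorphism_chart])

lemma cmap_cinv: "is_chart c \<Longrightarrow> y \<in> cmap c ` cdom c \<Longrightarrow> cmap c (cinv c y) = y"
  by (rule homeomorphism_apply2[OF homeomorphism_chart])

lemma cinv_in_cdom: "is_chart c \<Longrightarrow> y \<in> cmap c ` cdom c \<Longrightarrow> cinv c y \<in> cdom c"
  by (auto simp: cinv_cmap)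

lemma chart_image_subset_half_space: "is_chart c \<Longrightarrow> cmap c ` cdom c \<subseteq> half_space"
  unfolding is_chart_def by (blast dest: openin_imp_subset)

text \<open>A relatively open subset of the half-space is open in the full space away from the
  boundary plane.\<close>

lemma cmap_interior:
  assumes "is_chart c" "x \<in> cdom c" "cmap c x $ 3 \<noteq> 0"
  shows "cmap c x \<in> interior (cmap c ` cdom c)"
proof -
  obtain T where T: "open T" "cmap c ` cdom c = half_space \<inter> T"
    using assms(1) by (auto simp: is_chart_def openin_open)
  have "open (T \<inter> {y. 0 < y $ 3})"
    using T by (intro open_Int open_Collect_less continuous_intros)
  moreover have "T \<inter> {y. 0 < y $ 3} \<subseteq> cmap c ` cdom c"
    using T by (auto simp: half_space_def)
  moreover have "cmap c x \<in> T \<inter> {y. 0 < y $ 3}"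
  proof -
    have "cmap c x \<in> half_space \<inter> T" using T assms(2) by blast
    then show ?thesis using assms(3) by (simp add: half_space_def)
  qed
  ultimately show ?thesis by (meson interiorI)
qed

lemma isCont_cinv:
  assumes "is_chart c" "y \<in> interior (cmap c ` cdom c)"
  shows "isCont (cinv c) y"
  by (rule continuous_on_interior[OF homeomorphism_cont2[OF homeomorphism_chart[OF assms(1)]] assms(2)])

text \<open>Near such a point the half-space is a full neighbourhood, so the one-sided derivative of
  the definition becomes an ordinary one.\<close>

lemma chart_deriv_interior:
  assumes "is_chart c" "y \<in> interior (cmap c ` cdom c)"
  shows "chart_deriv c f (cinv c y) = frechet_derivative (f \<circ> cinv c) (at y)"
proof -
  have "cmap c (cinv c y) = y"
    by (rule cmap_cinv[OF assms(1) subsetD[OF interior_subset assms(2)]])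
  moreover have "y \<in> interior half_space"
    using interior_mono[OF chart_image_subset_half_space[OF assms(1)]] assms(2) by auto
  from at_within_interior[OF this] have "at y within half_space = at y" .
  ultimately show ?thesis by (simp add: chart_deriv_def)
qed

lemma matrix_mul_matrix_inv:
  fixes M :: "real^'n^'n"
  assumes "det M \<noteq> 0"
  shows "M ** matrix_inv M = mat 1"
proof -
  have "\<exists>M'. M ** M' = mat 1 \<and> M' ** M = mat 1"
    using assms invertible_det_nz[of M] unfolding invertible_def by blast
  from someI_ex[OF this] show ?thesis by (simp add: matrix_inv_def)
qed

text \<open>All data are read in the coordinates of a single chart, over the open set
  \<open>U\<close> where ordinary derivatives apply.\<close>

locale equilibrium_chart =
  fixes A :: "'m::{t2_space,second_countable_topology} chart set"
    and g :: "'m metric_tensor" and B :: "'m vfield" and p :: "'m \<Rightarrow> real" and c :: "'m chart"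
  assumes manifold: "oriented_3_manifold A" and metric: "riemannian_metric A g"
    and equilibrium: "mhd_equilibrium A g B p" and c: "c \<in> A"
begin

definition U where "U = interior (cmap c ` cdom c)"
definition b where "b = B c \<circ> cinv c"
definition G where "G = g c \<circ> cinv c"
definition P where "P = p \<circ> cinv c"
definition \<rho> where "\<rho> y = vol_density g c (cinv c y)"
text \<open>The one-form dual to the magnetic field, as a vector of components.\<close>

definition \<beta> where "\<beta> y = G y *v b y"
definition N where "N y = matrix (frechet_derivative \<beta> (at y))"
definition dP :: "real^3 \<Rightarrow> real^3" where "dP y = (\<chi> i. frechet_derivative P (at y) (axis i 1))"

text \<open>The fields \<open>J\<close> and \<open>B\<close> multiplied by the volume density are divergence free in the
  Euclidean sense.\<close>

definition X where "X y = axial (N y)"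
definition Y where "Y y = \<rho> y *\<^sub>R b y"

lemma is_chart: "is_chart c"
  using manifold c by (simp add: oriented_3_manifold_def)

lemma open_U: "open U"
  by (simp add: U_def)

lemma eventually_U: "y \<in> U \<Longrightarrow> \<forall>\<^sub>F z in nhds y. z \<in> U"
  using open_U eventually_nhds_in_open by blast

lemma U_image: "y \<in> U \<Longrightarrow> y \<in> cmap c ` cdom c"
  unfolding U_def by (rule subsetD[OF interior_subset])

lemma U_cdom: "y \<in> U \<Longrightarrow> cinv c y \<in> cdom c"
  using cinv_in_cdom is_chart U_image by blast

lemma partial_U: "y \<in> U \<Longrightarrow> partial c i f (cinv c y) = frechet_derivative (f \<circ> cinv c) (at y) (axis i 1)"
  using chart_deriv_interior[OF is_chart, of y f] by (simp add: partial_def U_def)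

lemma twice_b: "y \<in> U \<Longrightarrow> twice_differentiable_at b y"
  unfolding U_def b_def
  by (rule smooth_on_imp_twice_differentiable_at)
    (use equilibrium c in \<open>simp_all add: mhd_equilibrium_def smooth_vector_field_def\<close>)

lemma twice_G: "y \<in> U \<Longrightarrow> twice_differentiable_at G y"
  unfolding U_def G_def
  by (rule smooth_on_imp_twice_differentiable_at)
    (use metric c in \<open>simp_all add: riemannian_metric_def\<close>)

lemma twice_P: "y \<in> U \<Longrightarrow> twice_differentiable_at P y"
  unfolding U_def P_def
  by (rule smooth_on_imp_twice_differentiable_at)
    (use equilibrium c in \<open>simp_all add: mhd_equilibrium_def smooth_function_def\<close>)

lemma twice_\<beta>: "y \<in> U \<Longrightarrow> twice_differentiable_at \<beta> y"
  using twice_differentiable_at_bilinear[OF bounded_bilinear_matrix_vector twice_G twice_b]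
  by (simp add: \<beta>_def[abs_def])

lemma G_symmetric: "y \<in> U \<Longrightarrow> transpose (G y) = G y"
  using metric c U_cdom unfolding riemannian_metric_def G_def comp_def by blast

lemma G_positive: "y \<in> U \<Longrightarrow> v \<noteq> 0 \<Longrightarrow> v \<bullet> (G y *v v) > 0"
  using metric c U_cdom unfolding riemannian_metric_def G_def comp_def by blast

lemma det_G: "y \<in> U \<Longrightarrow> det (G y) > 0"
  by (rule det_pos_if_positive_definite[OF G_symmetric G_positive])

lemma \<rho>_eq: "\<rho> y = sqrt (det (G y))"
  by (simp add: \<rho>_def vol_density_def G_def)

lemma \<rho>_pos: "y \<in> U \<Longrightarrow> \<rho> y > 0"
  using det_G by (simp add: \<rho>_eq)

lemma N_nth: "N y $ j $ i = frechet_derivative \<beta> (at y) (axis i 1) $ j"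
  by (simp add: N_def matrix_def)

lemma N_nth':
  assumes "y \<in> U"
  shows "N y $ j $ i = frechet_derivative (\<lambda>z. \<beta> z $ j) (at y) (axis i 1)"
  using frechet_derivative_vec_nth[OF twice_differentiable_at_imp_differentiable[OF twice_\<beta>[OF assms]]]
  by (simp add: N_nth)

text \<open>The exterior derivative of \<open>\<beta>\<close> involves no metric, so the Riemannian
  curl is the Euclidean curl of \<open>\<beta>\<close> up to the density.\<close>

lemma curl_eq:
  assumes "y \<in> U"
  shows "curl g B c (cinv c y) = (1 / \<rho> y) *\<^sub>R X y"
proof -
  have "partial c i (\<lambda>x. flat g B c x $ j) (cinv c y) = N y $ j $ i" for i j
    unfolding N_nth'[OF assms] partial_U[OF assms]
    by (simp add: flat_def \<beta>_def G_def b_def comp_def)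
  then show ?thesis
    by (simp add: curl_def \<rho>_def X_def axial_def)
qed

lemma dP_nth: "dP y $ i = frechet_derivative P (at y) (axis i 1)"
  by (simp add: dP_def)

text \<open>The Gram matrix is invertible; this strips \<open>sharp\<close> from both sides of the
  equilibrium equation.\<close>

lemma sharp_cancel:
  assumes "y \<in> U" "matrix_inv (G y) *v v = matrix_inv (G y) *v w"
  shows "v = w"
proof -
  have "G y *v (matrix_inv (G y) *v u) = u" for u
    using det_G[OF assms(1)] by (simp add: matrix_vector_mul_assoc matrix_mul_matrix_inv)
  then show ?thesis using assms(2) by metis
qed

text \<open>Without \<open>sharp\<close> the equilibrium equation reads \<open>\<rho>\<close> J x B
  = dP. Scaling J to \<open>X\<close> absorbs this factor, and scaling B to \<open>Y\<close>
  introduces one on the right.\<close>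

lemma cross_X_Y:
  assumes "y \<in> U"
  shows "cross3 (X y) (Y y) = \<rho> y *\<^sub>R dP y"
proof -
  have "cross_product g (curl g B) B c (cinv c y) = grad g p c (cinv c y)"
    using equilibrium c U_cdom[OF assms] by (simp add: mhd_equilibrium_def)
  moreover have "(\<chi> i. partial c i p (cinv c y)) = dP y"
    by (simp add: partial_U[OF assms] dP_def P_def)
  ultimately have "\<rho> y *\<^sub>R cross3 (curl g B c (cinv c y)) (b y) = dP y"
    using sharp_cancel[OF assms]
    by (simp add: cross_product_def grad_def sharp_def G_def b_def \<rho>_def)
  then have "cross3 (X y) (b y) = dP y"
    using \<rho>_pos[OF assms] by (simp add: curl_eq[OF assms] cross_mult_left)
  then show ?thesis by (simp add: Y_def cross_mult_right)
qed

section \<open>Differentiability and Euclidean divergence of the scaled fields\<close>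

lemma \<rho>_differentiable:
  assumes "y \<in> U"
  shows "\<rho> differentiable (at y)"
proof -
  have "G differentiable (at y)"
    using twice_G[OF assms] by (rule twice_differentiable_at_imp_differentiable)
  then have "(\<lambda>z. G z $ i $ j) differentiable (at y)" for i j
    by (intro differentiable_vec_nth)
  then have "(\<lambda>z. det (G z)) differentiable (at y)"
    unfolding det_3 by (intro differentiable_add differentiable_diff differentiable_mult)
  then obtain D where D: "((\<lambda>z. det (G z)) has_derivative D) (at y)"
    unfolding differentiable_def by blast
  show ?thesis
    unfolding \<rho>_eq[abs_def]
    by (rule differentiableI[OF has_derivative_real_sqrt[OF det_G[OF assms] D]])
qed

lemma Y_differentiable: "y \<in> U \<Longrightarrow> Y differentiable (at y)"
  unfolding Y_def[abs_def]
  by (intro differentiable_scaleR \<rho>_differentiable twice_differentiable_at_imp_differentiable twice_b)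

lemma N_differentiable:
  assumes "y \<in> U"
  shows "(\<lambda>z. N z $ j $ i) differentiable (at y)"
proof -
  have "(\<lambda>z. frechet_derivative \<beta> (at z) (axis i 1)) differentiable (at y)"
    using twice_\<beta>[OF assms] by (simp add: twice_differentiable_at_def)
  then show ?thesis
    unfolding N_nth by (rule differentiable_vec_nth)
qed

lemma X_differentiable:
  assumes "y \<in> U"
  shows "X differentiable (at y)"
proof (rule differentiable_vecI)
  fix j
  show "(\<lambda>z. X z $ j) differentiable (at y)"
    using exhaust_3[of j] N_differentiable[OF assms]
    by (auto simp: X_def axial_def)
qed

lemma dP_differentiable:
  assumes "y \<in> U"
  shows "dP differentiable (at y)"
  using twice_P[OF assms]
  by (intro differentiable_vecI) (simp add: dP_nth twice_differentiable_at_def)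

lemma N_derivative_symmetric:
  assumes "y \<in> U"
  shows "frechet_derivative (\<lambda>z. N z $ j $ i) (at y) (axis k 1) =
    frechet_derivative (\<lambda>z. N z $ j $ k) (at y) (axis i 1)"
proof -
  have "\<forall>\<^sub>F z in nhds y. N z $ j $ i = frechet_derivative (\<lambda>z. \<beta> z $ j) (at z) (axis i 1)" for i
    using eventually_U[OF assms] by eventually_elim (rule N_nth')
  note eq = frechet_derivative_cong_nhds[OF this]
  have "twice_differentiable_at (\<lambda>z. \<beta> z $ j) y"
    using twice_\<beta>[OF assms] by (rule twice_differentiable_at_bounded_linear[OF bounded_linear_vec_nth])
  then show ?thesis unfolding eq by (rule second_derivative_symmetric)
qed

text \<open>The Euclidean div curl vanishes: the second partial derivatives of
  \<open>\<beta>\<close> cancel in pairs.\<close>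

lemma div_X:
  assumes "y \<in> U"
  shows "(\<Sum>i\<in>UNIV. frechet_derivative X (at y) (axis i 1) $ i) = 0"
proof -
  have diff: "frechet_derivative (\<lambda>z. N z $ j $ i - N z $ i $ j) (at y) v =
      frechet_derivative (\<lambda>z. N z $ j $ i) (at y) v - frechet_derivative (\<lambda>z. N z $ i $ j) (at y) v"
    for i j v
    using has_derivative_diff[OF N_differentiable[OF assms, of j i, unfolded frechet_derivative_works]
        N_differentiable[OF assms, of i j, unfolded frechet_derivative_works]]
    by (simp add: frechet_derivative_at[symmetric])
  have "frechet_derivative X (at y) v $ i = frechet_derivative (\<lambda>z. X z $ i) (at y) v" for i v
    using frechet_derivative_vec_nth[OF X_differentiable[OF assms]] by simp
  then show ?thesis
    by (simp add: sum_3 X_def axial_def diff)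
      (simp add: N_derivative_symmetric[OF assms, of 3 2 1] N_derivative_symmetric[OF assms, of 2 3 1]
        N_derivative_symmetric[OF assms, of 1 3 2])
qed

text \<open>The coordinate formula for the Riemannian divergence is the Euclidean divergence of
  \<open>\<rho>\<close> B divided by \<open>\<rho>\<close>.\<close>

lemma div_Y:
  assumes "y \<in> U"
  shows "(\<Sum>i\<in>UNIV. frechet_derivative Y (at y) (axis i 1) $ i) = 0"
proof -
  have "divergence g B c (cinv c y) = 0"
    using equilibrium c U_cdom[OF assms] by (simp add: mhd_equilibrium_def)
  then have "(\<Sum>i\<in>UNIV. partial c i (\<lambda>x. vol_density g c x * B c x $ i) (cinv c y)) = 0"
    using \<rho>_pos[OF assms] by (simp add: divergence_def \<rho>_def)
  moreover have "partial c i (\<lambda>x. vol_density g c x * B c x $ i) (cinv c y) =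
      frechet_derivative Y (at y) (axis i 1) $ i" for i
    using frechet_derivative_vec_nth[OF Y_differentiable[OF assms], of i]
    by (simp add: partial_U[OF assms] comp_def Y_def[abs_def] \<rho>_def b_def)
  ultimately show ?thesis by simp
qed

text \<open>The Hessian of \<open>P\<close> as a linear map.\<close>

abbreviation H where "H y \<equiv> frechet_derivative dP (at y)"

lemma H_linear: "y \<in> U \<Longrightarrow> linear (H y)"
  using dP_differentiable linear_frechet_derivative by blast

lemma H_nth:
  assumes "y \<in> U"
  shows "H y v $ j = frechet_derivative (\<lambda>z. frechet_derivative P (at z) (axis j 1)) (at y) v"
  using frechet_derivative_vec_nth[OF dP_differentiable[OF assms], of j v]
  by (simp add: dP_nth)

lemma H_symmetric:
  assumes "y \<in> U"
  shows "H y (axis i 1) $ j = H y (axis j 1) $ i"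
  unfolding H_nth[OF assms] using twice_P[OF assms] by (rule second_derivative_symmetric)

lemma hessian_eq:
  assumes "y \<in> U"
  shows "hessian c p (cinv c y) u v = H y u \<bullet> v"
proof -
  have "\<forall>\<^sub>F z in nhds y. (partial c j p \<circ> cinv c) z = frechet_derivative P (at z) (axis j 1)" for j
    using eventually_U[OF assms] by eventually_elim (simp add: partial_U P_def)
  note eq = frechet_derivative_cong_nhds[OF this]
  have "partial c i (partial c j p) (cinv c y) = H y (axis i 1) $ j" for i j
    unfolding partial_U[OF assms] eq H_nth[OF assms] ..
  then show ?thesis
    unfolding hessian_def linear_expand_3[OF H_linear[OF assms], of u]
    by (simp add: sum_3 inner_vec_def algebra_simps)
qed

lemma H_inner_symmetric:
  assumes "y \<in> U"
  shows "H y u \<bullet> v = H y v \<bullet> u"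
  unfolding linear_expand_3[OF H_linear[OF assms], of u] linear_expand_3[OF H_linear[OF assms], of v]
  using H_symmetric[OF assms, of 1 2] H_symmetric[OF assms, of 2 3] H_symmetric[OF assms, of 1 3]
  by (simp add: inner_vec_def sum_3 algebra_simps)

text \<open>Differentiate \<open>cross_X_Y\<close>; the term with the derivative of
  \<open>\<rho>\<close> carries the factor \<open>dP y\<close>, which is zero.\<close>

lemma cross_derivative_critical:
  assumes "y \<in> U" "dP y = 0"
  shows "cross3 (frechet_derivative X (at y) v) (Y y) + cross3 (X y) (frechet_derivative Y (at y) v) =
    \<rho> y *\<^sub>R H y v"
proof -
  have cd: "((\<lambda>z. cross3 (X z) (Y z)) has_derivative
      (\<lambda>v. cross3 (X y) (frechet_derivative Y (at y) v) + cross3 (frechet_derivative X (at y) v) (Y y))) (at y)"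
    by (intro bounded_bilinear.FDERIV[OF bounded_bilinear_cross3])
      (simp_all add: frechet_derivative_works[symmetric] X_differentiable Y_differentiable assms)
  have rd: "((\<lambda>z. \<rho> z *\<^sub>R dP z) has_derivative
      (\<lambda>v. \<rho> y *\<^sub>R H y v + frechet_derivative \<rho> (at y) v *\<^sub>R dP y)) (at y)"
    by (intro has_derivative_scaleR)
      (simp_all add: frechet_derivative_works[symmetric] \<rho>_differentiable dP_differentiable assms)
  have ev: "\<forall>\<^sub>F z in nhds y. cross3 (X z) (Y z) = \<rho> z *\<^sub>R dP z"
    using eventually_U[OF assms(1)] by eventually_elim (rule cross_X_Y)
  have "(\<lambda>v. cross3 (X y) (frechet_derivative Y (at y) v) + cross3 (frechet_derivative X (at y) v) (Y y))
      = (\<lambda>v. \<rho> y *\<^sub>R H y v + frechet_derivative \<rho> (at y) v *\<^sub>R dP y)"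
    by (rule has_derivative_unique[OF has_derivative_cong_nhds[OF ev, THEN iffD1, OF cd] rd])
  from fun_cong[OF this, of v] show ?thesis using assms by (simp add: add.commute)
qed

text \<open>Differentiating the orthogonality relation at a critical point leaves
  \<open>H y v \<bullet> F y = 0\<close> for every \<open>v\<close>; symmetry moves \<open>H\<close>
  onto \<open>F y\<close>.\<close>

lemma H_kernel_if_orthogonal:
  assumes "y \<in> U" "dP y = 0" "F differentiable (at y)" "\<And>z. z \<in> U \<Longrightarrow> dP z \<bullet> F z = 0"
  shows "H y (F y) = 0"
proof -
  have "((\<lambda>z. dP z \<bullet> F z) has_derivative
      (\<lambda>v. dP y \<bullet> frechet_derivative F (at y) v + H y v \<bullet> F y)) (at y)"
    by (intro has_derivative_inner)
      (simp_all add: frechet_derivative_works[symmetric] dP_differentiable assms)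
  moreover have "\<forall>\<^sub>F z in nhds y. dP z \<bullet> F z = 0"
    using eventually_U[OF assms(1)] by eventually_elim (rule assms(4))
  then have "((\<lambda>z. dP z \<bullet> F z) has_derivative (\<lambda>v. 0)) (at y)"
    using has_derivative_cong_nhds[of "\<lambda>z. dP z \<bullet> F z" "\<lambda>z. 0"] by simp
  ultimately have "(\<lambda>v. dP y \<bullet> frechet_derivative F (at y) v + H y v \<bullet> F y) = (\<lambda>v. 0)"
    by (rule has_derivative_unique)
  from fun_cong[OF this] have "H y v \<bullet> F y = 0" for v using assms by simp
  then have "H y (F y) \<bullet> H y (F y) = 0"
    using H_inner_symmetric[OF assms(1), of "F y"] by simp
  then show ?thesis by simp
qed

text \<open>A cross product is orthogonal to its factors, so \<open>dP\<close> is orthogonal to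
  \<open>X\<close> and \<open>Y\<close> on all of \<open>U\<close> and
  \<open>H_kernel_if_orthogonal\<close> applies to both.\<close>

lemma
  assumes "y \<in> U" "dP y = 0"
  shows X_kernel: "H y (X y) = 0" and Y_kernel: "H y (Y y) = 0"
proof -
  have "dP z \<bullet> X z = 0" "dP z \<bullet> Y z = 0" if "z \<in> U" for z
  proof -
    have "\<rho> z * (dP z \<bullet> w) = cross3 (X z) (Y z) \<bullet> w" for w
      by (simp add: cross_X_Y[OF that])
    from this[of "X z"] this[of "Y z"] show "dP z \<bullet> X z = 0" "dP z \<bullet> Y z = 0"
      using \<rho>_pos[OF that] by (simp_all add: dot_cross_self)
  qed
  then show "H y (X y) = 0" "H y (Y y) = 0"
    using assms by (auto intro: H_kernel_if_orthogonal X_differentiable Y_differentiable)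
qed

text \<open>At a critical point the derivative of the cross product is a multiple of the symmetric
  Hessian, so its curl vanishes there, and both fields are divergence free.\<close>

lemma X_Y_commute:
  assumes "y \<in> U" "dP y = 0"
  shows "frechet_derivative X (at y) (Y y) = frechet_derivative Y (at y) (X y)"
proof (rule solenoidal_commute[where X = "frechet_derivative X (at y)"
      and Y = "frechet_derivative Y (at y)" and a = "X y" and b = "Y y" and H = "H y" and r = "\<rho> y"])
  show "linear (frechet_derivative X (at y))" "linear (frechet_derivative Y (at y))"
    using assms by (simp_all add: linear_frechet_derivative X_differentiable Y_differentiable)
  show "cross3 (frechet_derivative X (at y) v) (Y y) + cross3 (X y) (frechet_derivative Y (at y) v) =
    \<rho> y *\<^sub>R H y v" for v
    using assms by (rule cross_derivative_critical)
qed (rule div_X div_Y H_symmetric, rule assms)+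

lemma H_zero_if_X_Y_zero:
  assumes "y \<in> U" "dP y = 0" "X y = 0" "Y y = 0"
  shows "H y v = 0"
  using cross_derivative_critical[OF assms(1,2), of v] \<rho>_pos[OF assms(1)] assms(3,4) by simp

section \<open>Local minima of the pressure\<close>

lemma has_derivative_P:
  assumes "y \<in> U"
  shows "(P has_derivative (\<lambda>v. dP y \<bullet> v)) (at y)"
proof -
  have P: "P differentiable (at y)"
    using twice_P[OF assms] by (rule twice_differentiable_at_imp_differentiable)
  have "frechet_derivative P (at y) = (\<lambda>v. dP y \<bullet> v)"
  proof
    fix v
    show "frechet_derivative P (at y) v = dP y \<bullet> v"
      by (subst linear_expand_3[OF linear_frechet_derivative[OF P]])
        (simp add: dP_nth inner_vec_def sum_3 mult.commute)
  qed
  then show ?thesis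
    using P unfolding frechet_derivative_works by simp
qed

text \<open>On the line through \<open>y\<close> in direction \<open>u\<close> the pressure has
  second derivative \<open>H y u \<bullet> u\<close> at \<open>y\<close>.\<close>

lemma H_nonneg_at_local_min:
  assumes "y \<in> U" "dP y = 0" "\<forall>\<^sub>F z in nhds y. P y \<le> P z"
  shows "0 \<le> H y u \<bullet> u"
proof (rule second_derivative_nonneg_at_local_min)
  let ?l = "\<lambda>s. y + s *\<^sub>R u"
  have l: "(?l has_derivative (\<lambda>t. t *\<^sub>R u)) (at s)" for s
    by (auto intro!: derivative_eq_intros)
  have "isCont ?l 0" by (intro continuous_intros)
  then have lim: "filterlim ?l (nhds y) (nhds 0)"
    using tendsto_at_iff_tendsto_nhds[of ?l 0] by (simp add: isCont_def)
  have "\<forall>\<^sub>F s in nhds 0. ?l s \<in> U"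
    using eventually_U[OF assms(1)] lim by (rule eventually_compose_filterlim)
  then show "\<forall>\<^sub>F s in nhds 0. ((\<lambda>s. P (?l s)) has_real_derivative (dP (?l s) \<bullet> u)) (at s)"
  proof eventually_elim
    case (elim s)
    from has_derivative_compose[OF l has_derivative_P[OF this]] show ?case
      by (simp add: has_field_derivative_def mult_commute_abs)
  qed
  show "((\<lambda>s. dP (?l s) \<bullet> u) has_real_derivative (H y u \<bullet> u)) (at 0)"
  proof -
    have "(dP has_derivative H y) (at (?l 0))"
      using dP_differentiable[OF assms(1)] by (simp add: frechet_derivative_works)
    from has_derivative_inner_left[OF has_derivative_compose[OF l this]] show ?thesis
      by (simp add: has_field_derivative_def linear_cmul[OF H_linear[OF assms(1)]] mult_commute_abs)
  qed
  show "dP (?l 0) \<bullet> u = 0" using assms by simp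
  show "\<forall>\<^sub>F s in nhds 0. P (?l 0) \<le> P (?l s)"
    using eventually_compose_filterlim[OF assms(3) lim] by simp
qed

text \<open>Where \<open>b\<close> vanishes, only its derivative \<open>b'\<close> survives in the
  derivatives of \<open>Y\<close> and \<open>\<beta>\<close>. Both \<open>X y\<close> and the
  Hessian are thereby expressed through \<open>b'\<close>, and nonnegativity of the Hessian becomes
  the hypothesis of \<open>axial_zero_if_cross_nonneg\<close>.\<close>

lemma X_zero_if_b_zero_at_local_min:
  assumes "y \<in> U" "dP y = 0" "\<forall>\<^sub>F z in nhds y. P y \<le> P z" "b y = 0"
  shows "X y = 0"
proof -
  define b' where "b' = frechet_derivative b (at y)"
  have b': "(b has_derivative b') (at y)"
    using twice_b[OF assms(1)]
    by (simp add: b'_def frechet_derivative_works[symmetric] twice_differentiable_at_imp_differentiable)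
  have "(\<rho> has_derivative frechet_derivative \<rho> (at y)) (at y)"
    using \<rho>_differentiable[OF assms(1)] by (simp add: frechet_derivative_works)
  from has_derivative_scaleR[OF this b'] have "frechet_derivative Y (at y) v = \<rho> y *\<^sub>R b' v" for v
    using assms(4) by (simp add: Y_def[abs_def] frechet_derivative_at[symmetric])
  then have "\<rho> y *\<^sub>R cross3 (X y) (b' v) = \<rho> y *\<^sub>R H y v" for v
    using cross_derivative_critical[OF assms(1,2), of v] assms(4)
    by (simp add: Y_def cross_mult_right)
  then have H: "H y v = cross3 (X y) (b' v)" for v
    using \<rho>_pos[OF assms(1)] by (metis order_less_irrefl scaleR_left_imp_eq)
  have "(G has_derivative frechet_derivative G (at y)) (at y)"
    using twice_G[OF assms(1)]
    by (simp add: frechet_derivative_works[symmetric] twice_differentiable_at_imp_differentiable)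
  from bounded_bilinear.FDERIV[OF bounded_bilinear_matrix_vector this b']
  have "(\<beta> has_derivative (\<lambda>v. G y *v b' v)) (at y)"
    using assms(4) by (simp add: \<beta>_def[abs_def])
  then have "N y = matrix (\<lambda>v. G y *v b' v)"
    by (simp add: N_def frechet_derivative_at[symmetric])
  also have "\<dots> = G y ** matrix b'"
    using matrix_compose[of b' "(*v) (G y)"] has_derivative_linear[OF b'] by (simp add: comp_def)
  finally have X: "X y = axial (G y ** matrix b')" by (simp add: X_def)
  have "0 \<le> cross3 (axial (G y ** matrix b')) (matrix b' *v u) \<bullet> u" for u
    using H_nonneg_at_local_min[OF assms(1-3), of u] has_derivative_linear[OF b']
    by (simp add: H X matrix_works)
  from axial_zero_if_cross_nonneg[OF G_symmetric[OF assms(1)] G_positive[OF assms(1)] this]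
  show ?thesis by (simp add: X)
qed

end

section \<open>Critical circles\<close>

text \<open>The curl is defined chart by chart; this makes it a vector field at interior points. The
  one-form \<open>\<beta>\<close> pulls back under the transition map, second derivatives of that
  map drop out by symmetry, and the determinant from \<open>axial_congruence\<close> cancels against
  the change of density.\<close>

lemma curl_transition:
  assumes "equilibrium_chart A g B p c" "equilibrium_chart A g B p d"
    and x: "x \<in> cdom c" "x \<in> cdom d" "x \<in> interior_points A"
  shows "curl g B d x = jacobian c d x *v curl g B c x"
proof -
  interpret C: equilibrium_chart A g B p c by fact
  interpret D: equilibrium_chart A g B p d by fact
  define \<phi> where "\<phi> = cmap d \<circ> cinv c"
  define y where "y = cmap c x"
  define z where "z = cmap d x"
  define M where "M = jacobian c d x"
  have nz: "y $ 3 \<noteq> 0" "z $ 3 \<noteq> 0"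
    using x C.c D.c by (auto simp: interior_points_def boundary_points_def y_def z_def)
  have y: "y \<in> C.U" and cy: "cinv c y = x"
    using cmap_interior[OF C.is_chart x(1)] cinv_cmap[OF C.is_chart x(1)] nz
    by (simp_all add: C.U_def y_def)
  have z: "z \<in> D.U" and dz: "cinv d z = x"
    using cmap_interior[OF D.is_chart x(2)] cinv_cmap[OF D.is_chart x(2)] nz
    by (simp_all add: D.U_def z_def)
  have \<phi>y: "\<phi> y = z" by (simp add: \<phi>_def cy z_def)

  \<comment> \<open>On this open set both charts are available, so identities between them may be
    differentiated.\<close>
  define W where "W = C.U \<inter> cinv c -` cdom d"
  have "continuous_on C.U (cinv c)"
    using isCont_cinv[OF C.is_chart] by (auto simp: C.U_def continuous_at_imp_continuous_on)
  then have W: "open W"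
    using D.is_chart C.open_U unfolding W_def is_chart_def by (simp add: continuous_open_preimage)
  have yW: "y \<in> W" using y cy x by (simp add: W_def)
  from W yW have evW: "\<forall>\<^sub>F w in nhds y. w \<in> W" by (rule eventually_nhds_in_open)
  have sub: "W \<subseteq> cmap c ` (cdom c \<inter> cdom d)"
  proof
    fix w assume "w \<in> W"
    then have "cinv c w \<in> cdom c \<inter> cdom d" "w = cmap c (cinv c w)"
      using C.U_cdom cmap_cinv[OF C.is_chart C.U_image] by (simp_all add: W_def)
    then show "w \<in> cmap c ` (cdom c \<inter> cdom d)" by (rule rev_image_eqI)
  qed
  from W yW sub have "y \<in> interior (cmap c ` (cdom c \<inter> cdom d))"
    by (rule interiorI)
  moreover have "smooth_on (cmap c ` (cdom c \<inter> cdom d)) \<phi>"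
    using C.manifold C.c D.c by (simp add: oriented_3_manifold_def \<phi>_def)
  ultimately have t\<phi>: "twice_differentiable_at \<phi> y"
    using smooth_on_imp_twice_differentiable_at by blast
  have jac: "jacobian c d (cinv c w) = matrix (frechet_derivative \<phi> (at w))" if "w \<in> W" for w
    using that chart_deriv_interior[OF C.is_chart, of w "cmap d"]
    by (simp add: W_def C.U_def jacobian_def \<phi>_def)

  have g: "g c x' = transpose (jacobian c d x') ** g d x' ** jacobian c d x'"
    and B: "B d x' = jacobian c d x' *v B c x'" if "x' \<in> cdom c \<inter> cdom d" for x'
    using C.metric C.equilibrium C.c D.c that
    unfolding riemannian_metric_def mhd_equilibrium_def smooth_vector_field_def by blast+
  have \<beta>: "C.\<beta> w $ j = frechet_derivative \<phi> (at w) (axis j 1) \<bullet> D.\<beta> (\<phi> w)" if "w \<in> W" for w j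
  proof -
    have w: "cinv c w \<in> cdom c \<inter> cdom d" using that C.U_cdom by (simp add: W_def)
    then have "cinv d (\<phi> w) = cinv c w"
      using cinv_cmap[OF D.is_chart, of "cinv c w"] by (simp add: \<phi>_def)
    then have "C.\<beta> w = transpose (matrix (frechet_derivative \<phi> (at w))) *v D.\<beta> (\<phi> w)"
      using g[OF w] B[OF w] jac[OF that]
      by (simp add: C.\<beta>_def D.\<beta>_def C.G_def D.G_def C.b_def D.b_def
          matrix_vector_mul_assoc matrix_mul_assoc)
    then show ?thesis
      by (simp add: matrix_vector_mult_def transpose_def matrix_def inner_vec_def)
  qed

  \<comment> \<open>The part of the Jacobian matrix of the pulled back one-form that comes from
    second derivatives of the transition map.\<close>
  define S where "S = (\<chi> j i. frechet_derivative (\<lambda>w. frechet_derivative \<phi> (at w) (axis j 1)) (at y) (axis i 1)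
      \<bullet> D.\<beta> z)"
  have \<phi>': "(\<phi> has_derivative frechet_derivative \<phi> (at y)) (at y)"
    using twice_differentiable_at_imp_differentiable[OF t\<phi>] by (simp add: frechet_derivative_works)
  have "(D.\<beta> has_derivative frechet_derivative D.\<beta> (at z)) (at (\<phi> y))"
    using twice_differentiable_at_imp_differentiable[OF D.twice_\<beta>[OF z]]
    by (simp add: frechet_derivative_works \<phi>y)
  note \<beta>\<phi> = has_derivative_compose[OF \<phi>' this]
  have M: "M = matrix (frechet_derivative \<phi> (at y))"
    using jac[OF yW] by (simp add: M_def cy)
  have N\<beta>: "frechet_derivative D.\<beta> (at z) v = D.N z *v v" for v
    unfolding D.N_def
    using twice_differentiable_at_imp_differentiable[OF D.twice_\<beta>[OF z]]
    by (simp add: matrix_works linear_frechet_derivative)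
  have M\<phi>: "frechet_derivative \<phi> (at y) (axis i 1) $ k = M $ k $ i" for i k
    by (simp add: M matrix_def)
  have "C.N y $ j $ i = (transpose M ** D.N z ** M) $ j $ i + S $ j $ i" for i j
  proof -
    let ?D = "\<lambda>w. frechet_derivative \<phi> (at w) (axis j 1)"
    have "?D differentiable (at y)"
      using t\<phi> by (simp add: twice_differentiable_at_def)
    then have "(?D has_derivative frechet_derivative ?D (at y)) (at y)"
      by (simp add: frechet_derivative_works)
    from has_derivative_inner[OF this \<beta>\<phi>]
    have der: "((\<lambda>w. ?D w \<bullet> D.\<beta> (\<phi> w)) has_derivative
        (\<lambda>v. ?D y \<bullet> (D.N z *v frechet_derivative \<phi> (at y) v) + frechet_derivative ?D (at y) v \<bullet> D.\<beta> z)) (at y)"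
      by (simp add: N\<beta> \<phi>y)
    have ev: "\<forall>\<^sub>F w in nhds y. C.\<beta> w $ j = ?D w \<bullet> D.\<beta> (\<phi> w)"
      using evW by eventually_elim (rule \<beta>)
    have "frechet_derivative (\<lambda>w. C.\<beta> w $ j) (at y) =
        (\<lambda>v. ?D y \<bullet> (D.N z *v frechet_derivative \<phi> (at y) v) + frechet_derivative ?D (at y) v \<bullet> D.\<beta> z)"
      unfolding frechet_derivative_cong_nhds[OF ev] by (rule frechet_derivative_at[OF der, symmetric])
    then show ?thesis
      unfolding C.N_nth'[OF y]
      by (simp add: S_def M\<phi> inner_vec_def matrix_vector_mult_def matrix_matrix_mult_def transpose_def
          sum_3 algebra_simps)
  qed
  then have "C.N y = transpose M ** D.N z ** M + S" by (simp add: vec_eq_iff)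
  moreover have "transpose S = S"
  proof -
    have "frechet_derivative (\<lambda>w. frechet_derivative \<phi> (at w) (axis j 1)) (at y) (axis i 1) $ k =
      frechet_derivative (\<lambda>w. frechet_derivative \<phi> (at w) (axis i 1)) (at y) (axis j 1) $ k" for i j k
    proof -
      \<comment> \<open>Passing to components reduces the claim to symmetry for real-valued
        maps.\<close>
      have comp: "frechet_derivative (\<lambda>w. frechet_derivative \<phi> (at w) u) (at y) v $ k =
          frechet_derivative (\<lambda>w. frechet_derivative (\<lambda>w. \<phi> w $ k) (at w) u) (at y) v" for u v
      proof -
        have "(\<lambda>w. frechet_derivative \<phi> (at w) u) differentiable (at y)"
          using t\<phi> by (simp add: twice_differentiable_at_def)
        note frechet_derivative_vec_nth[OF this, of k v, symmetric]
        also have "\<forall>\<^sub>F w in nhds y. \<phi> differentiable (at w)"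
          using t\<phi> by (simp add: twice_differentiable_at_def)
        then have "\<forall>\<^sub>F w in nhds y. frechet_derivative \<phi> (at w) u $ k =
            frechet_derivative (\<lambda>w. \<phi> w $ k) (at w) u"
          by eventually_elim (simp add: frechet_derivative_vec_nth)
        note frechet_derivative_cong_nhds[OF this]
        finally show ?thesis .
      qed
      show ?thesis
        unfolding comp
        using twice_differentiable_at_bounded_linear[OF bounded_linear_vec_nth t\<phi>]
        by (rule second_derivative_symmetric)
    qed
    then show ?thesis
      by (simp add: S_def transpose_def vec_eq_iff inner_vec_def)
  qed
  ultimately have "M *v C.X y = det M *\<^sub>R D.X z"
    by (simp add: C.X_def D.X_def axial_add_symmetric axial_congruence)
  moreover have pos: "det M > 0"
    using C.manifold C.c D.c x unfolding oriented_3_manifold_def M_def by blast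
  \<comment> \<open>The charts are equally oriented, so the square root of the squared determinant
    is the determinant itself.\<close>
  moreover have "C.\<rho> y = det M * D.\<rho> z"
  proof -
    have "det (C.G y) = (det M)\<^sup>2 * det (D.G z)"
      using g[of x] x by (simp add: C.G_def D.G_def cy dz M_def det_mul power2_eq_square)
    then show ?thesis
      using pos by (simp add: C.\<rho>_eq D.\<rho>_eq real_sqrt_mult)
  qed
  ultimately have "(1 / C.\<rho> y) *\<^sub>R (M *v C.X y) = (1 / D.\<rho> z) *\<^sub>R D.X z"
    by simp
  then show ?thesis
    using C.curl_eq[OF y] D.curl_eq[OF z] by (simp add: cy dz M_def matrix_vector_mult_scaleR)
qed

section \<open>The critical circle in one chart\<close>

lemma (in equilibrium_chart) critical_circle_point:
  assumes \<gamma>: "\<gamma> \<subseteq> interior_points A" "morse_bott_critical A p \<gamma>"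
    and x: "x \<in> \<gamma>" "x \<in> cdom c"
  shows "cmap c x \<in> U" and "cinv c (cmap c x) = x" and "dP (cmap c x) = 0"
proof -
  have "cmap c x $ 3 \<noteq> 0"
    using \<gamma>(1) x c by (auto simp: interior_points_def boundary_points_def)
  then show U: "cmap c x \<in> U"
    using cmap_interior[OF is_chart x(2)] by (simp add: U_def)
  show inv: "cinv c (cmap c x) = x"
    using cinv_cmap[OF is_chart x(2)] .
  have "partial c i p x = 0" for i
    using \<gamma>(2) x c by (simp add: morse_bott_critical_def)
  then show "dP (cmap c x) = 0"
    using partial_U[OF U, of _ p] by (simp add: inv vec_eq_iff dP_nth P_def)
qed

lemma (in equilibrium_chart) curve_chart:
  assumes "smooth_curve A a" "a t \<in> cdom c"
  shows "\<forall>\<^sub>F s in nhds t. a s \<in> cdom c"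
    and "((\<lambda>s. cmap c (a s)) has_vector_derivative velocity c a t) (at t)"
proof -
  have op: "open (a -` cdom c)"
    using assms is_chart by (auto simp: smooth_curve_def is_chart_def intro: open_vimage)
  from eventually_nhds_in_open[OF this, of t] assms show "\<forall>\<^sub>F s in nhds t. a s \<in> cdom c"
    by simp
  have "smooth_on (a -` cdom c) (cmap c \<circ> a)"
    using assms c by (simp add: smooth_curve_def)
  then have "twice_differentiable_at (cmap c \<circ> a) t"
    by (rule smooth_on_imp_twice_differentiable_at) (simp add: interior_open[OF op] assms(2))
  then have "(cmap c \<circ> a) differentiable (at t)"
    by (rule twice_differentiable_at_imp_differentiable)
  then show "((\<lambda>s. cmap c (a s)) has_vector_derivative velocity c a t) (at t)"
    unfolding vector_derivative_works by (simp add: velocity_def comp_def)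
qed

text \<open>By nondegeneracy the kernel of the Hessian is the tangent line of the circle.\<close>

lemma (in equilibrium_chart) parallel_on_critical_circle:
  assumes \<gamma>: "\<gamma> \<subseteq> interior_points A" "morse_bott_critical A p \<gamma>"
    and a: "smooth_curve A a" "range a \<subseteq> \<gamma>" "a t \<in> cdom c" "velocity c a t \<noteq> 0"
  defines "y \<equiv> cmap c (a t)"
  obtains \<xi> \<eta> where "X y = \<xi> *\<^sub>R velocity c a t" "Y y = \<eta> *\<^sub>R velocity c a t" "\<xi> \<noteq> 0 \<or> \<eta> \<noteq> 0"
proof -
  define v where "v = velocity c a t"
  have at: "a t \<in> \<gamma>" using a(2) by auto
  note yU = critical_circle_point(1)[OF \<gamma> at a(3), folded y_def]
    and cy = critical_circle_point(2)[OF \<gamma> at a(3), folded y_def]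
    and dP = critical_circle_point(3)[OF \<gamma> at a(3), folded y_def]
  obtain \<pi> where \<pi>: "subspace \<pi>" "dim \<pi> = 2"
    and nondeg: "\<And>u. u \<in> \<pi> \<Longrightarrow> (\<And>w. w \<in> \<pi> \<Longrightarrow> hessian c p (a t) u w = 0) \<Longrightarrow> u = 0"
    using \<gamma>(2) at a(3) c unfolding morse_bott_critical_def by blast
  have triv: "u = 0" if "u \<in> \<pi>" "H y u = 0" for u
    using nondeg[OF that(1)] hessian_eq[OF yU] that(2) by (simp add: cy)
  \<comment> \<open>Differentiate \<open>dP\<close> along the curve, where it vanishes
    identically.\<close>
  have "H y v = 0"
  proof -
    have "(dP has_derivative H y) (at y)"
      using dP_differentiable[OF yU] by (simp add: frechet_derivative_works)
    with curve_chart(2)[OF a(1,3)]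
    have "((\<lambda>s. dP (cmap c (a s))) has_derivative (\<lambda>r. H y (r *\<^sub>R v))) (at t)"
      unfolding has_vector_derivative_def v_def y_def by (rule has_derivative_compose)
    moreover have "\<forall>\<^sub>F s in nhds t. dP (cmap c (a s)) = 0"
      using curve_chart(1)[OF a(1,3)]
      by eventually_elim (use critical_circle_point(3)[OF \<gamma>] a(2) in blast)
    then have "((\<lambda>s. dP (cmap c (a s))) has_derivative (\<lambda>r. 0)) (at t)"
      using has_derivative_cong_nhds[of "\<lambda>s. dP (cmap c (a s))" "\<lambda>s. 0"] by simp
    ultimately have "(\<lambda>r. H y (r *\<^sub>R v)) = (\<lambda>r. 0)" by (rule has_derivative_unique)
    from fun_cong[OF this, of 1] show ?thesis by simp
  qed
  moreover have "subspace {w. H y w = 0}"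
    using linear_subspace_kernel[OF H_linear[OF yU]] .
  ultimately have "\<exists>k. w = k *\<^sub>R v" if "H y w = 0" for w
    using kernel_spanned_if_nondegenerate[OF \<pi>, of "{w. H y w = 0}" v w] that triv a(4)
    by (auto simp: v_def)
  then obtain \<xi> \<eta> where *: "X y = \<xi> *\<^sub>R v" "Y y = \<eta> *\<^sub>R v"
    using X_kernel[OF yU dP] Y_kernel[OF yU dP] by blast
  \<comment> \<open>A common zero would make the Hessian vanish, and nondegeneracy would then
    collapse the plane.\<close>
  have "\<not> (X y = 0 \<and> Y y = 0)"
  proof
    assume "X y = 0 \<and> Y y = 0"
    then have "\<pi> \<subseteq> {0}" using H_zero_if_X_Y_zero[OF yU dP] triv by blast
    then show False using \<pi>(2) by (metis dim_eq_0 zero_neq_numeral)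
  qed
  then have "\<xi> \<noteq> 0 \<or> \<eta> \<noteq> 0" using * by auto
  then show ?thesis using * that by (auto simp: v_def)
qed

text \<open>For the tangent multiples \<open>\<xi>\<close>, \<open>\<eta>\<close> of the velocity,
  commutation of the fields becomes a relation between their derivatives along the curve, which is
  the hypothesis of \<open>locally_constant_ratio\<close>. That hypothesis is symmetric in the two
  fields, so either may be the denominator.\<close>

lemma (in equilibrium_chart) ratio_on_critical_circle:
  assumes \<gamma>: "\<gamma> \<subseteq> interior_points A" "morse_bott_critical A p \<gamma>"
    and a: "smooth_curve A a" "range a \<subseteq> \<gamma>" "a t \<in> cdom c"
    and imm: "\<And>s. a s \<in> cdom c \<Longrightarrow> velocity c a s \<noteq> 0"
  defines "x \<equiv> \<lambda>s. X (cmap c (a s))" and "y \<equiv> \<lambda>s. Y (cmap c (a s))"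
  shows "y t \<noteq> 0 \<Longrightarrow> \<exists>k. \<forall>\<^sub>F s in nhds t. y s \<noteq> 0 \<and> x s = k *\<^sub>R y s"
    and "x t \<noteq> 0 \<Longrightarrow> \<exists>k. \<forall>\<^sub>F s in nhds t. x s \<noteq> 0 \<and> y s = k *\<^sub>R x s"
proof -
  let ?X' = "\<lambda>s. frechet_derivative X (at (cmap c (a s)))"
  let ?Y' = "\<lambda>s. frechet_derivative Y (at (cmap c (a s)))"
  let ?v = "velocity c a"
  have main: "(x has_vector_derivative ?X' s (?v s)) (at s) \<and>
      (y has_vector_derivative ?Y' s (?v s)) (at s) \<and>
      (\<exists>\<xi> \<eta>. x s = \<xi> *\<^sub>R ?v s \<and> y s = \<eta> *\<^sub>R ?v s \<and> \<xi> *\<^sub>R ?Y' s (?v s) = \<eta> *\<^sub>R ?X' s (?v s))"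
    if s: "a s \<in> cdom c" for s
  proof (intro conjI)
    have as: "a s \<in> \<gamma>" using a(2) by auto
    note yU = critical_circle_point(1)[OF \<gamma> as s] and dP = critical_circle_point(3)[OF \<gamma> as s]
    have X': "(X has_derivative ?X' s) (at (cmap c (a s)))"
      and Y': "(Y has_derivative ?Y' s) (at (cmap c (a s)))"
      using X_differentiable[OF yU] Y_differentiable[OF yU] by (simp_all add: frechet_derivative_works)
    note lin = linear_cmul[OF has_derivative_linear[OF X']] linear_cmul[OF has_derivative_linear[OF Y']]
    show "(x has_vector_derivative ?X' s (?v s)) (at s)" "(y has_vector_derivative ?Y' s (?v s)) (at s)"
      using has_derivative_compose[OF curve_chart(2)[OF a(1) s, unfolded has_vector_derivative_def] X']
        has_derivative_compose[OF curve_chart(2)[OF a(1) s, unfolded has_vector_derivative_def] Y']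
      by (simp_all add: has_vector_derivative_def x_def y_def lin)
    obtain \<xi> \<eta> where *: "x s = \<xi> *\<^sub>R ?v s" "y s = \<eta> *\<^sub>R ?v s"
      using parallel_on_critical_circle[OF \<gamma> a(1,2) s imm[OF s]] unfolding x_def y_def by metis
    have "?X' s (\<eta> *\<^sub>R ?v s) = ?Y' s (\<xi> *\<^sub>R ?v s)"
      using X_Y_commute[OF yU dP] * by (simp add: x_def y_def)
    then have "\<xi> *\<^sub>R ?Y' s (?v s) = \<eta> *\<^sub>R ?X' s (?v s)"
      by (simp add: lin)
    with * show "\<exists>\<xi> \<eta>. x s = \<xi> *\<^sub>R ?v s \<and> y s = \<eta> *\<^sub>R ?v s \<and> \<xi> *\<^sub>R ?Y' s (?v s) = \<eta> *\<^sub>R ?X' s (?v s)"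
      by (intro exI[of _ \<xi>] exI[of _ \<eta>]) simp
  qed
  have ev: "\<forall>\<^sub>F s in nhds t. a s \<in> cdom c" using curve_chart(1)[OF a(1,3)] .
  have ev1: "\<forall>\<^sub>F s in nhds t. (x has_vector_derivative ?X' s (?v s)) (at s) \<and>
      (y has_vector_derivative ?Y' s (?v s)) (at s) \<and>
      (\<exists>\<xi> \<eta>. x s = \<xi> *\<^sub>R ?v s \<and> y s = \<eta> *\<^sub>R ?v s \<and> \<xi> *\<^sub>R ?Y' s (?v s) = \<eta> *\<^sub>R ?X' s (?v s))"
    using ev by eventually_elim (rule main)
  have ev2: "\<forall>\<^sub>F s in nhds t. (y has_vector_derivative ?Y' s (?v s)) (at s) \<and>
      (x has_vector_derivative ?X' s (?v s)) (at s) \<and>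
      (\<exists>\<xi> \<eta>. y s = \<xi> *\<^sub>R ?v s \<and> x s = \<eta> *\<^sub>R ?v s \<and> \<xi> *\<^sub>R ?X' s (?v s) = \<eta> *\<^sub>R ?Y' s (?v s))"
    using ev1 by eventually_elim metis
  show "y t \<noteq> 0 \<Longrightarrow> \<exists>k. \<forall>\<^sub>F s in nhds t. y s \<noteq> 0 \<and> x s = k *\<^sub>R y s"
    by (rule locally_constant_ratio[OF ev1]) blast+
  show "x t \<noteq> 0 \<Longrightarrow> \<exists>k. \<forall>\<^sub>F s in nhds t. x s \<noteq> 0 \<and> y s = k *\<^sub>R x s"
    by (rule locally_constant_ratio[OF ev2]) blast+
qed

text \<open>Continuity of \<open>cinv c\<close> carries the minimum on the manifold over to the
  coordinate function \<open>P\<close>.\<close>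

lemma (in equilibrium_chart) curl_zero_at_local_min:
  assumes \<gamma>: "\<gamma> \<subseteq> interior_points A" "morse_bott_critical A p \<gamma>"
    and x: "x \<in> \<gamma>" "x \<in> cdom c" and min: "\<forall>\<^sub>F x' in nhds x. p x \<le> p x'" and "B c x = 0"
  shows "curl g B c x = 0"
proof -
  note yU = critical_circle_point(1)[OF \<gamma> x] and cy = critical_circle_point(2)[OF \<gamma> x]
    and dP = critical_circle_point(3)[OF \<gamma> x]
  have "isCont (cinv c) (cmap c x)"
    using isCont_cinv[OF is_chart] yU by (simp add: U_def)
  then have lim: "filterlim (cinv c) (nhds x) (nhds (cmap c x))"
    using tendsto_at_iff_tendsto_nhds[of "cinv c" "cmap c x"] by (simp add: isCont_def cy)
  have "\<forall>\<^sub>F z in nhds (cmap c x). P (cmap c x) \<le> P z"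
    using eventually_compose_filterlim[OF min lim] by (simp add: P_def cy)
  moreover have "b (cmap c x) = 0" using assms by (simp add: b_def cy)
  ultimately have "X (cmap c x) = 0" by (intro X_zero_if_b_zero_at_local_min yU dP)
  then show ?thesis using curl_eq[OF yU] by (simp add: cy)
qed

section \<open>Independence of the chart and passage to the whole circle\<close>

lemma vf_scaled_at_iff:
  assumes V: "\<And>d. d \<in> A \<Longrightarrow> x \<in> cdom d \<Longrightarrow> V d x = jacobian c d x *v V c x"
    and W: "\<And>d. d \<in> A \<Longrightarrow> x \<in> cdom d \<Longrightarrow> W d x = jacobian c d x *v W c x"
    and c: "c \<in> A" "x \<in> cdom c"
  shows "vf_scaled_at A V k W x \<longleftrightarrow> V c x = k *\<^sub>R W c x"
proof
  assume eq: "V c x = k *\<^sub>R W c x"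
  show "vf_scaled_at A V k W x"
    unfolding vf_scaled_at_def
  proof (intro ballI impI)
    fix d assume d: "d \<in> A" "x \<in> cdom d"
    show "V d x = k *\<^sub>R W d x"
      unfolding V[OF d] W[OF d] eq by (rule matrix_vector_mult_scaleR)
  qed
qed (use c in \<open>simp add: vf_scaled_at_def\<close>)

lemma vf_zero_at_iff:
  assumes "\<And>d. d \<in> A \<Longrightarrow> x \<in> cdom d \<Longrightarrow> V d x = jacobian c d x *v V c x"
    and "c \<in> A" "x \<in> cdom c"
  shows "vf_zero_at A V x \<longleftrightarrow> V c x = 0"
  using vf_scaled_at_iff[of A x V c V 0, OF assms(1) assms(1) assms(2,3)]
  by (simp add: vf_zero_at_def vf_scaled_at_def)

text \<open>The circle is traced by a curve on the real line, so local constancy along it becomes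
  global by connectedness of the line.\<close>

locale critical_circle =
  fixes A :: "'m::{t2_space,second_countable_topology} chart set"
    and g :: "'m metric_tensor" and B :: "'m vfield" and p :: "'m \<Rightarrow> real"
    and \<gamma> :: "'m set" and a :: "real \<Rightarrow> 'm"
  assumes manifold: "oriented_3_manifold A" and metric: "riemannian_metric A g"
    and equilibrium: "mhd_equilibrium A g B p"
    and \<gamma>: "\<gamma> \<subseteq> interior_points A" "morse_bott_critical A p \<gamma>"
    and curve: "smooth_curve A a" "range a = \<gamma>"
    and immersion: "\<And>t c. c \<in> A \<Longrightarrow> a t \<in> cdom c \<Longrightarrow> velocity c a t \<noteq> 0"
begin

abbreviation J where "J \<equiv> curl g B"

lemma chart: "c \<in> A \<Longrightarrow> equilibrium_chart A g B p c"
  using manifold metric equilibrium by unfold_locales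

lemma chart_at: obtains c where "c \<in> A" "x \<in> cdom c"
  using manifold unfolding oriented_3_manifold_def by blast

text \<open>Both fields transform by the Jacobian, \<open>J\<close> thanks to
  \<open>curl_transition\<close>, so any one chart decides.\<close>

lemma
  assumes x: "x \<in> \<gamma>" "c \<in> A" "x \<in> cdom c"
  shows B_zero_iff: "vf_zero_at A B x \<longleftrightarrow> B c x = 0"
    and J_zero_iff: "vf_zero_at A J x \<longleftrightarrow> J c x = 0"
    and scaled_iff: "vf_scaled_at A J k B x \<longleftrightarrow> J c x = k *\<^sub>R B c x"
proof -
  have B: "B d x = jacobian c d x *v B c x" if "d \<in> A" "x \<in> cdom d" for d
    using equilibrium x that unfolding mhd_equilibrium_def smooth_vector_field_def by blast
  have J: "J d x = jacobian c d x *v J c x" if "d \<in> A" "x \<in> cdom d" for d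
    using curl_transition[OF chart[OF x(2)] chart[OF that(1)] x(3) that(2)] x(1) \<gamma>(1) by blast
  show "vf_zero_at A B x \<longleftrightarrow> B c x = 0"
    by (rule vf_zero_at_iff[of A x B c, OF B x(2,3)])
  show "vf_zero_at A J x \<longleftrightarrow> J c x = 0"
    by (rule vf_zero_at_iff[of A x J c, OF J x(2,3)])
  show "vf_scaled_at A J k B x \<longleftrightarrow> J c x = k *\<^sub>R B c x"
    by (rule vf_scaled_at_iff[of A x J c B, OF J B x(2,3)])
qed

lemma curve_point: "a t \<in> \<gamma>"
  using curve(2) by auto

text \<open>The fields \<open>X\<close> and \<open>Y\<close> are \<open>J\<close> and
  \<open>B\<close> times the same positive density.\<close>

lemma XY_iff:
  assumes "c \<in> A" "a t \<in> cdom c"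
  shows "equilibrium_chart.Y g B c (cmap c (a t)) = 0 \<longleftrightarrow> B c (a t) = 0"
    and "equilibrium_chart.X g B c (cmap c (a t)) = 0 \<longleftrightarrow> J c (a t) = 0"
    and "equilibrium_chart.X g B c (cmap c (a t)) = k *\<^sub>R equilibrium_chart.Y g B c (cmap c (a t)) \<longleftrightarrow>
      J c (a t) = k *\<^sub>R B c (a t)"
    and "equilibrium_chart.Y g B c (cmap c (a t)) = k *\<^sub>R equilibrium_chart.X g B c (cmap c (a t)) \<longleftrightarrow>
      B c (a t) = k *\<^sub>R J c (a t)"
proof -
  interpret C: equilibrium_chart A g B p c using chart assms(1) .
  note y = C.critical_circle_point[OF \<gamma> curve_point assms(2)]
  have Y: "C.Y (cmap c (a t)) = C.\<rho> (cmap c (a t)) *\<^sub>R B c (a t)"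
    by (simp add: C.Y_def C.b_def y(2))
  have X: "C.X (cmap c (a t)) = C.\<rho> (cmap c (a t)) *\<^sub>R J c (a t)"
    using C.curl_eq[OF y(1)] C.\<rho>_pos[OF y(1)] by (simp add: y(2))
  show "C.Y (cmap c (a t)) = 0 \<longleftrightarrow> B c (a t) = 0" "C.X (cmap c (a t)) = 0 \<longleftrightarrow> J c (a t) = 0"
    "C.X (cmap c (a t)) = k *\<^sub>R C.Y (cmap c (a t)) \<longleftrightarrow> J c (a t) = k *\<^sub>R B c (a t)"
    "C.Y (cmap c (a t)) = k *\<^sub>R C.X (cmap c (a t)) \<longleftrightarrow> B c (a t) = k *\<^sub>R J c (a t)"
    using C.\<rho>_pos[OF y(1)]
    by (simp_all add: X Y scaleR_left_commute[of k "C.\<rho> (cmap c (a t))"] del: scaleR_scaleR)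
qed

lemma no_common_zero: "\<not> (vf_zero_at A B (a t) \<and> vf_zero_at A J (a t))"
proof -
  obtain c where c: "c \<in> A" "a t \<in> cdom c" using chart_at .
  interpret C: equilibrium_chart A g B p c using chart c(1) .
  obtain \<xi> \<eta> where "C.X (cmap c (a t)) = \<xi> *\<^sub>R velocity c a t"
      "C.Y (cmap c (a t)) = \<eta> *\<^sub>R velocity c a t" "\<xi> \<noteq> 0 \<or> \<eta> \<noteq> 0"
    using C.parallel_on_critical_circle[OF \<gamma> curve(1) _ c(2) immersion[OF c]] curve(2) by blast
  then show ?thesis
    using XY_iff(1,2)[OF c] immersion[OF c]
    by (auto simp: B_zero_iff[OF curve_point c] J_zero_iff[OF curve_point c])
qed

lemma locally_scaled:
  assumes "\<not> vf_zero_at A B (a t)"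
  shows "\<exists>k. \<forall>\<^sub>F s in nhds t. \<not> vf_zero_at A B (a s) \<and> vf_scaled_at A J k B (a s)"
proof -
  obtain c where c: "c \<in> A" "a t \<in> cdom c" using chart_at .
  interpret C: equilibrium_chart A g B p c using chart c(1) .
  have "C.Y (cmap c (a t)) \<noteq> 0"
    using assms by (simp add: XY_iff(1)[OF c] B_zero_iff[OF curve_point c])
  then obtain k where "\<forall>\<^sub>F s in nhds t. C.Y (cmap c (a s)) \<noteq> 0 \<and>
      C.X (cmap c (a s)) = k *\<^sub>R C.Y (cmap c (a s))"
    using C.ratio_on_critical_circle(1)[OF \<gamma> curve(1) _ c(2) immersion[OF c(1)]] curve(2) by blast
  then have "\<forall>\<^sub>F s in nhds t. \<not> vf_zero_at A B (a s) \<and> vf_scaled_at A J k B (a s)"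
    using C.curve_chart(1)[OF curve(1) c(2)]
    by eventually_elim
      (simp add: XY_iff[OF c(1)] B_zero_iff[OF curve_point c(1)] scaled_iff[OF curve_point c(1)])
  then show ?thesis ..
qed

text \<open>At a zero of \<open>B\<close> the field \<open>J\<close> is nonzero, so nearby
  \<open>B\<close> is a constant multiple of \<open>J\<close>, and the zero makes that constant
  0.\<close>

lemma zero_set_open:
  assumes "vf_zero_at A B (a t)"
  shows "\<forall>\<^sub>F s in nhds t. vf_zero_at A B (a s)"
proof -
  obtain c where c: "c \<in> A" "a t \<in> cdom c" using chart_at .
  interpret C: equilibrium_chart A g B p c using chart c(1) .
  have "\<not> vf_zero_at A J (a t)" using no_common_zero assms by blast
  then have "C.X (cmap c (a t)) \<noteq> 0"
    by (simp add: XY_iff(2)[OF c] J_zero_iff[OF curve_point c])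
  then obtain k where k: "\<forall>\<^sub>F s in nhds t. C.X (cmap c (a s)) \<noteq> 0 \<and>
      C.Y (cmap c (a s)) = k *\<^sub>R C.X (cmap c (a s))"
    using C.ratio_on_critical_circle(2)[OF \<gamma> curve(1) _ c(2) immersion[OF c(1)]] curve(2) by blast
  have "C.Y (cmap c (a t)) = 0"
    using assms by (simp add: XY_iff(1)[OF c] B_zero_iff[OF curve_point c])
  then have "k = 0" using eventually_nhds_x_imp_x[OF k] by simp
  show ?thesis
    using k C.curve_chart(1)[OF curve(1) c(2)]
    by eventually_elim (use \<open>k = 0\<close> in \<open>simp add: XY_iff(1)[OF c(1)] B_zero_iff[OF curve_point c(1)]\<close>)
qed

text \<open>The zero set of \<open>B\<close> and its complement are both open along the curve, and
  the real line is connected.\<close>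

lemma zero_constant: "vf_zero_at A B (a s) = vf_zero_at A B (a t)"
proof (rule connected_local_const[where A = UNIV and f = "\<lambda>t. vf_zero_at A B (a t)"])
  show "\<forall>t\<in>UNIV. \<forall>\<^sub>F s in at t. vf_zero_at A B (a t) = vf_zero_at A B (a s)"
  proof
    fix t
    have "\<forall>\<^sub>F s in nhds t. vf_zero_at A B (a t) = vf_zero_at A B (a s)"
    proof (cases "vf_zero_at A B (a t)")
      case True
      then show ?thesis using zero_set_open by simp
    next
      case False
      then show ?thesis using locally_scaled[OF False] by (auto elim: eventually_mono)
    qed
    then show "\<forall>\<^sub>F s in at t. vf_zero_at A B (a t) = vf_zero_at A B (a s)"
      by (simp add: eventually_nhds_conv_at)
  qed
qed auto

lemma scale_unique:
  assumes "\<not> vf_zero_at A B (a t)" "vf_scaled_at A J k B (a t)" "vf_scaled_at A J k' B (a t)"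
  shows "k = k'"
proof -
  obtain c where c: "c \<in> A" "a t \<in> cdom c" using chart_at .
  then show ?thesis
    using assms by (auto simp: B_zero_iff[OF curve_point c] scaled_iff[OF curve_point c])
qed

lemma globally_scaled:
  assumes nz: "\<And>t. \<not> vf_zero_at A B (a t)"
  shows "\<exists>k. \<forall>t. vf_scaled_at A J k B (a t)"
proof -
  \<comment> \<open>The factor is chosen point by point; uniqueness forces it to agree with the
    locally constant factor of \<open>locally_scaled\<close>.\<close>
  define \<kappa> where "\<kappa> t = (SOME k. vf_scaled_at A J k B (a t))" for t
  have ex: "\<exists>k. vf_scaled_at A J k B (a t)" for t
    using locally_scaled[OF nz] eventually_nhds_x_imp_x by blast
  have \<kappa>: "vf_scaled_at A J (\<kappa> t) B (a t)" for t
    unfolding \<kappa>_def using ex by (rule someI_ex)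
  have "\<kappa> t = \<kappa> 0" for t
  proof (rule connected_local_const[where A = UNIV and f = \<kappa>])
    show "\<forall>t\<in>UNIV. \<forall>\<^sub>F s in at t. \<kappa> t = \<kappa> s"
    proof
      fix t
      obtain k where k: "\<forall>\<^sub>F s in nhds t. \<not> vf_zero_at A B (a s) \<and> vf_scaled_at A J k B (a s)"
        using locally_scaled[OF nz] by blast
      have "k = \<kappa> t" using scale_unique[OF nz] \<kappa> eventually_nhds_x_imp_x[OF k] by blast
      moreover have "\<forall>\<^sub>F s in nhds t. k = \<kappa> s"
        using k by eventually_elim (use scale_unique[OF nz] \<kappa> in blast)
      ultimately show "\<forall>\<^sub>F s in at t. \<kappa> t = \<kappa> s"
        by (simp add: eventually_nhds_conv_at)
    qed
  qed auto
  then have "\<forall>t. vf_scaled_at A J (\<kappa> 0) B (a t)" using \<kappa> by metis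
  then show ?thesis ..
qed

lemma dichotomy:
  "((\<forall>x\<in>\<gamma>. vf_zero_at A B x) \<and> (\<forall>x\<in>\<gamma>. \<not> vf_zero_at A J x)) \<or>
   ((\<forall>x\<in>\<gamma>. \<not> vf_zero_at A B x) \<and> (\<exists>k. \<forall>x\<in>\<gamma>. vf_scaled_at A J k B x))"
proof (cases "vf_zero_at A B (a 0)")
  case True
  then have "vf_zero_at A B (a t)" for t using zero_constant by blast
  then show ?thesis using no_common_zero curve(2) by blast
next
  case False
  then have nz: "\<not> vf_zero_at A B (a t)" for t using zero_constant by blast
  then show ?thesis using globally_scaled[OF nz] curve(2) by blast
qed

text \<open>At a minimum a zero of \<open>B\<close> would also be a zero of \<open>J\<close>, which
  \<open>no_common_zero\<close> excludes.\<close>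

lemma not_all_zero_if_minimised:
  assumes "locally_minimised_on p \<gamma>"
  shows "\<not> (\<forall>x\<in>\<gamma>. vf_zero_at A B x)"
proof
  assume "\<forall>x\<in>\<gamma>. vf_zero_at A B x"
  then have zero: "vf_zero_at A B (a 0)" using curve_point by blast
  obtain c where c: "c \<in> A" "a 0 \<in> cdom c" using chart_at .
  interpret C: equilibrium_chart A g B p c using chart c(1) .
  have "J c (a 0) = 0"
    using C.curl_zero_at_local_min[OF \<gamma> curve_point c(2)] assms zero curve_point
    by (simp add: locally_minimised_on_def B_zero_iff[OF curve_point c])
  then show False
    using no_common_zero[of 0] zero by (simp add: J_zero_iff[OF curve_point c])
qed

end

theorem proposition1p11:
  fixes A :: "'m::{t2_space,second_countable_topology} chart set"
    and g :: "'m metric_tensor"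
    and B :: "'m vfield"
    and p :: "'m \<Rightarrow> real"
    and \<gamma> :: "'m set"
  assumes "oriented_3_manifold A"
    and "riemannian_metric A g"
    and "mhd_equilibrium A g B p"
    and "embedded_circle A \<gamma>"
    and "\<gamma> \<subseteq> interior_points A"
    and "morse_bott_critical A p \<gamma>"
  shows "let J = curl g B in
     (locally_maximised_on p \<gamma> \<longrightarrow>
        ((\<forall>x\<in>\<gamma>. vf_zero_at A B x) \<and> (\<forall>x\<in>\<gamma>. \<not> vf_zero_at A J x)) \<or>
        ((\<forall>x\<in>\<gamma>. \<not> vf_zero_at A B x) \<and> (\<exists>k. \<forall>x\<in>\<gamma>. vf_scaled_at A J k B x))) \<and>
     (locally_minimised_on p \<gamma> \<longrightarrow>
        (\<forall>x\<in>\<gamma>. \<not> vf_zero_at A B x) \<and> (\<exists>k. \<forall>x\<in>\<gamma>. vf_scaled_at A J k B x))"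
proof -
  obtain f h where f: "homeomorphism (sphere (0::complex) 1) \<gamma> f h" "smooth_curve A (f \<circ> cis)"
      "\<And>t c. c \<in> A \<Longrightarrow> f (cis t) \<in> cdom c \<Longrightarrow> velocity c (f \<circ> cis) t \<noteq> 0"
    using assms(4) unfolding embedded_circle_def by blast
  have "range cis = sphere 0 1"
  proof
    show "sphere 0 1 \<subseteq> range cis"
    proof
      fix z :: complex assume "z \<in> sphere 0 1"
      then have z: "norm z = 1" by simp
      then have "z \<noteq> 0" by auto
      from cis_Arg[OF this] have "cis (Arg z) = z" by (simp add: sgn_div_norm z)
      then show "z \<in> range cis" by (metis rangeI)
    qed
  qed auto
  then have "range (f \<circ> cis) = \<gamma>"
    using homeomorphism_image1[OF f(1)] by (metis image_comp)
  moreover have "velocity c (f \<circ> cis) t \<noteq> 0" if "c \<in> A" "(f \<circ> cis) t \<in> cdom c" for t c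
    using f(3) that by simp
  ultimately interpret critical_circle A g B p \<gamma> "f \<circ> cis"
    using assms(1-3,5,6) f(2) by (intro critical_circle.intro)
  \<comment> \<open>The first claim is the dichotomy; at a minimum its first alternative is ruled
    out.\<close>
  show ?thesis
    unfolding Let_def using dichotomy not_all_zero_if_minimised by blast
qed

end
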